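(* Assume that $f:\mathbb{S}^1\to\mathbb{S}^1$ is a continuous degree one map that is piecewise monotone with finitely many pieces and has constant slope $\lambda>1$. Assume also that $f$ has a lifting $F:\mathbb{R}\to\mathbb{R}$ that is topologically transitive. Let $g:[0,1]\to[0,1]$ be any continuous interval map such that $g|_{(0,1)}$ is topologically conjugate to $F$. Then there does not exist any nondecreasing semiconjugacy of $g$ to an interval map of constant slope (for any value of the slope).
   Context: $\mathbb{S}^1=\mathbb{R}/\mathbb{Z}$, with natural projection $\pi:\mathbb{R}\to\mathbb{S}^1$. A lifting of $f$ is a continuous $F:\mathbb{R}\to\mathbb{R}$ with $\pi\circ F=f\circ\pi$; degree one means $F(x+1)=F(x)+1$. The circle map $f$ is piecewise monotone with finitely many pieces and of constant slope $\lambda$ if there is a finite set $P\subset\mathbb{S}^1$ such that on each component of $\mathbb{S}^1\setminus P$ the map $f$ is monotone and affine (in the coordinate of the lifting) with slope of absolute value $\lambda$. $F$ is topologically transitive if for all nonempty open $U,V\subset\mathbb{R}$ there is $n\geq 1$ with $F^n(U)\cap V\ne\emptyset$. That $g|_{(0,1)}$ is topologically conjugate to $F$ means $g((0,1))\subset(0,1)$ and there is a homeomorphism $h:(0,1)\to\mathbb{R}$ with $h\circ g|_{(0,1)}=F\circ h$. An interval map of constant slope $\lambda'>0$ is a continuous map $k:[0,1]\to[0,1]$ for which there is a closed countable set $Q\subset[0,1]$ such that on each connected component of $[0,1]\setminus Q$ the map $k$ is affine with slope of absolute value $\lambda'$. A nondecreasing semiconjugacy of $g$ to $k$ is a continuous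 nondecreasing surjection $\varphi:[0,1]\to[0,1]$ with $\varphi\circ g=k\circ\varphi$. *)

theory Defs
  imports "HOL-Analysis.Analysis"
begin

definition int_cong :: "real \<Rightarrow> real \<Rightarrow> bool" where
  "int_cong x y \<longleftrightarrow> x - y \<in> \<int>"

lemma equivp_int_cong: "equivp int_cong"
proof (rule equivpI)
  show "reflp int_cong"
    by (simp add: reflp_def int_cong_def)
  show "symp int_cong"
    unfolding symp_def int_cong_def by (metis Ints_minus minus_diff_eq)
  show "transp int_cong"
    unfolding transp_def int_cong_def by (metis Ints_add diff_add_cancel add_diff_eq)
qed

quotient_type circle = real / int_cong
  by (rule equivp_int_cong)

definition circle_proj :: "real \<Rightarrow> circle" where
  "circle_proj = abs_circle"

text \<open>The circle carries the quotient topology.\<close>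

instantiation circle :: topological_space
begin

definition open_circle :: "circle set \<Rightarrow> bool" where
  "open_circle U \<longleftrightarrow> open (circle_proj -` U)"

instance
  by standard (auto simp: open_circle_def vimage_Union)

end

definition lifting :: "(circle \<Rightarrow> circle) \<Rightarrow> (real \<Rightarrow> real) \<Rightarrow> bool" where
  "lifting f F \<longleftrightarrow> continuous_on UNIV F \<and> circle_proj \<circ> F = f \<circ> circle_proj"

text \<open>Two liftings of the same map differ by an integer constant, so the two notions below
  do not depend on the lifting used to express them.\<close>

definition degree_one :: "(circle \<Rightarrow> circle) \<Rightarrow> bool" where
  "degree_one f \<longleftrightarrow> (\<exists>F. lifting f F \<and> (\<forall>x. F (x + 1) = F x + 1))"

definition affine_with_slope_on :: "real set \<Rightarrow> real \<Rightarrow> (real \<Rightarrow> real) \<Rightarrow> bool" where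
  "affine_with_slope_on J s F \<longleftrightarrow> (\<exists>b. \<forall>x\<in>J. F x = s * x + b)"

text \<open>A component \<open>C\<close> of the complement of \<open>P\<close> is read in the coordinate of the lifting, that is,
  on the intervals \<open>J\<close> which are the components of its preimage in the line. Monotonicity on
  \<open>J\<close> follows from affinity and is listed only because it is part of the notion.\<close>

definition circle_constant_slope :: "(circle \<Rightarrow> circle) \<Rightarrow> real \<Rightarrow> bool" where
  "circle_constant_slope f lam \<longleftrightarrow>
    (\<exists>F P. lifting f F \<and> finite P \<and>
      (\<forall>C \<in> components (UNIV - P). \<forall>J \<in> components (circle_proj -` C).
        (mono_on J F \<or> antimono_on J F) \<and>
        (\<exists>s. \<bar>s\<bar> = lam \<and> affine_with_slope_on J s F)))"

definition topologically_transitive :: "(real \<Rightarrow> real) \<Rightarrow> bool" where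
  "topologically_transitive F \<longleftrightarrow>
    (\<forall>U V. open U \<and> U \<noteq> {} \<and> open V \<and> V \<noteq> {} \<longrightarrow> (\<exists>n\<ge>1. (F ^^ n) ` U \<inter> V \<noteq> {}))"

text \<open>Maps of the unit interval are functions on the reals of which only the values on
  \<open>{0..1}\<close> matter.\<close>

definition interval_map :: "(real \<Rightarrow> real) \<Rightarrow> bool" where
  "interval_map g \<longleftrightarrow> continuous_on {0..1} g \<and> g ` {0..1} \<subseteq> {0..1}"

definition interior_conjugate :: "(real \<Rightarrow> real) \<Rightarrow> (real \<Rightarrow> real) \<Rightarrow> bool" where
  "interior_conjugate g F \<longleftrightarrow>
    g ` {0<..<1} \<subseteq> {0<..<1} \<and>
    (\<exists>h h'. homeomorphism {0<..<1} UNIV h h' \<and> (\<forall>x\<in>{0<..<1}. h (g x) = F (h x)))"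

definition interval_constant_slope :: "(real \<Rightarrow> real) \<Rightarrow> real \<Rightarrow> bool" where
  "interval_constant_slope k \<mu> \<longleftrightarrow>
    interval_map k \<and>
    (\<exists>Q. closed Q \<and> countable Q \<and> Q \<subseteq> {0..1} \<and>
      (\<forall>J \<in> components ({0..1} - Q). \<exists>s. \<bar>s\<bar> = \<mu> \<and> affine_with_slope_on J s k))"

definition nondecreasing_semiconjugacy ::
    "(real \<Rightarrow> real) \<Rightarrow> (real \<Rightarrow> real) \<Rightarrow> (real \<Rightarrow> real) \<Rightarrow> bool" where
  "nondecreasing_semiconjugacy \<phi> g k \<longleftrightarrow>
    continuous_on {0..1} \<phi> \<and> mono_on {0..1} \<phi> \<and> \<phi> ` {0..1} = {0..1} \<and>
    (\<forall>x\<in>{0..1}. \<phi> (g x) = k (\<phi> x))"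

end

theory Submission
  imports Defs
begin

text \<open>
  Let \<open>h\<close> be the conjugacy of \<open>g\<close> to \<open>F\<close>. A semiconjugacy \<open>\<phi>\<close> to a map of slope \<open>\<mu>\<close> turns into a bounded
  monotone function \<open>v = \<plusminus>\<phi> \<circ> h\<^sup>-\<^sup>1\<close> on the line whose increments \<open>F\<close> multiplies by \<open>\<plusminus>\<mu>\<close>, whereas it
  multiplies lengths by \<open>\<plusminus>\<lambda>\<close>. By transitivity \<open>v\<close> is strictly increasing. Cutting an interval at the turning
  points of an iterate of large slope and following the pieces shows that increments of such functions grow
  at the same rate as lengths; applied to \<open>v\<close> and to the sum of its integer translates this gives \<open>\<mu> = \<lambda>\<close>.
  Since \<open>v\<close> is bounded, \<open>v (x + \<delta>) - v x\<close> tends to \<open>0\<close> at both ends of the line and so attains its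
  maximum \<open>s \<delta>\<close>. The growth estimate shows that \<open>v\<close> is \<open>s\<close>-Lipschitz, so that \<open>s x - v x\<close> is monotone and
  constant on the maximising interval. By transitivity again it is constant, and \<open>v\<close> is unbounded.
\<close>

section \<open>Local dilations and compatible functions\<close>

text \<open>The signs \<open>\<sigma>\<close> and \<open>\<tau>\<close> are the directions of the segment and of its image.\<close>
definition ray_affine :: "(real \<Rightarrow> real) \<Rightarrow> real \<Rightarrow> real \<Rightarrow> real \<Rightarrow> real \<Rightarrow> real \<Rightarrow> bool" where
  "ray_affine G L x \<sigma> \<tau> e \<longleftrightarrow> (\<forall>t\<in>{0..e}. G (x + \<sigma> * t) = G x + \<tau> * L * t)"

text \<open>The two sides of a point are treated separately, so turning points are allowed, and the
  property passes to iterates without a list of their turning points.\<close>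

definition locally_affine :: "(real \<Rightarrow> real) \<Rightarrow> real \<Rightarrow> bool" where
  "locally_affine G L \<longleftrightarrow>
    (\<forall>x. \<forall>\<sigma>\<in>{-1, 1}. \<exists>e>0. \<exists>\<tau>\<in>{-1, 1}. ray_affine G L x \<sigma> \<tau> e)"

text \<open>The increments of \<open>v\<close> are those of a measure that \<open>G\<close> multiplies by \<open>m\<close> wherever it is affine;
  \<open>v\<close> itself need not be monotone.\<close>
definition conformal :: "(real \<Rightarrow> real) \<Rightarrow> real \<Rightarrow> real \<Rightarrow> (real \<Rightarrow> real) \<Rightarrow> bool" where
  "conformal G L m v \<longleftrightarrow>
    (\<forall>x. \<forall>e\<ge>0. \<forall>\<sigma>\<in>{-1, 1}. \<forall>\<tau>\<in>{-1, 1}. ray_affine G L x \<sigma> \<tau> e \<longrightarrow>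
      v (G (x + \<sigma> * e)) - v (G x) = \<sigma> * \<tau> * m * (v (x + \<sigma> * e) - v x))"

lemma ray_affineD: "ray_affine G L x \<sigma> \<tau> e \<Longrightarrow> 0 \<le> t \<Longrightarrow> t \<le> e \<Longrightarrow> G (x + \<sigma> * t) = G x + \<tau> * L * t"
  by (simp add: ray_affine_def)

lemma ray_affine_mono: "ray_affine G L x \<sigma> \<tau> e \<Longrightarrow> d \<le> e \<Longrightarrow> ray_affine G L x \<sigma> \<tau> d"
  by (auto simp: ray_affine_def)

lemma conformalD:
  assumes "conformal G L m v" "ray_affine G L x \<sigma> \<tau> e" "\<sigma> \<in> {-1, 1}" "\<tau> \<in> {-1, 1}" "0 \<le> e"
  shows "v (G (x + \<sigma> * e)) - v (G x) = \<sigma> * \<tau> * m * (v (x + \<sigma> * e) - v x)"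
  using assms unfolding conformal_def by blast

lemma conformal_scale:
  assumes "conformal G L m v" shows "conformal G L m (\<lambda>x. c * v x)"
  unfolding conformal_def
proof (intro allI ballI impI)
  fix x e \<sigma> \<tau> :: real
  assume "\<sigma> \<in> {-1, 1}" "\<tau> \<in> {-1, 1}" "0 \<le> e" "ray_affine G L x \<sigma> \<tau> e"
  then have "v (G (x + \<sigma> * e)) - v (G x) = \<sigma> * \<tau> * m * (v (x + \<sigma> * e) - v x)"
    using conformalD[OF assms] by blast
  then have "c * (v (G (x + \<sigma> * e)) - v (G x)) = c * (\<sigma> * \<tau> * m * (v (x + \<sigma> * e) - v x))"
    by simp
  then show "c * v (G (x + \<sigma> * e)) - c * v (G x) = \<sigma> * \<tau> * m * (c * v (x + \<sigma> * e) - c * v x)"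
    by (simp add: algebra_simps)
qed

text \<open>Constancy on both one-sided neighbourhoods gives local constancy, and intervals are
  connected. The one-sided form is what affine segments provide.\<close>

lemma interval_local_const:
  fixes w :: "real \<Rightarrow> real"
  assumes side: "\<And>x \<rho>. x \<in> {a..b} \<Longrightarrow> \<rho> \<in> {-1, 1} \<Longrightarrow>
      \<exists>d>0. \<forall>t\<in>{0..d}. x + \<rho> * t \<in> {a..b} \<longrightarrow> w x = w (x + \<rho> * t)"
    and pq: "p \<in> {a..b}" "q \<in> {a..b}"
  shows "w p = w q"
proof (rule connected_local_const[of "{a..b}" p q w])
  show "\<forall>x\<in>{a..b}. eventually (\<lambda>y. w x = w y) (at x within {a..b})"
  proof
    fix x assume x: "x \<in> {a..b}"
    obtain d where d: "d > 0" "\<And>t. t \<in> {0..d} \<Longrightarrow> x + t \<in> {a..b} \<Longrightarrow> w x = w (x + t)"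
      using side[OF x, of 1] by auto
    obtain d' where d': "d' > 0" "\<And>t. t \<in> {0..d'} \<Longrightarrow> x - t \<in> {a..b} \<Longrightarrow> w x = w (x - t)"
      using side[OF x, of "-1"] by auto
    have "w x = w t" if "t \<in> {a..b}" "dist t x < min d d'" for t
    proof (cases "x \<le> t")
      case True then show ?thesis using d(2)[of "t - x"] that by (auto simp: dist_real_def)
    next
      case False then show ?thesis using d'(2)[of "x - t"] that by (auto simp: dist_real_def)
    qed
    then show "eventually (\<lambda>t. w x = w t) (at x within {a..b})"
      unfolding eventually_at using d(1) d'(1) by (intro exI[of _ "min d d'"]) auto
  qed
qed (use pq in auto)

text \<open>Induction along the orbit: a short segment issuing from \<open>x\<close> arrives at
  \<open>(F ^^ n) x\<close> as a segment of direction \<open>\<tau>\<close>, short enough to be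
  affine for the next step. Intermediate directions square to 1 and drop out.\<close>

lemma funpow_local:
  assumes L: "L > 0" and loc: "locally_affine F L" and conf: "conformal F L m v"
    and \<sigma>: "\<sigma> \<in> {-1, 1}"
  shows "\<exists>e>0. \<exists>\<tau>\<in>{-1, 1}. \<forall>t\<in>{0..e}. (F ^^ n) (x + \<sigma> * t) = (F ^^ n) x + \<tau> * L ^ n * t \<and>
    v ((F ^^ n) (x + \<sigma> * t)) - v ((F ^^ n) x) = \<sigma> * \<tau> * m ^ n * (v (x + \<sigma> * t) - v x)"
proof (induction n)
  case 0
  have "\<sigma> * \<sigma> = 1" using \<sigma> by auto
  then show ?case using \<sigma> by (intro exI[of _ 1] conjI bexI[of _ \<sigma>]) auto
next
  case (Suc n)
  then obtain e \<tau> where e: "e > 0" "\<tau> \<in> {-1, 1}"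
    and 1: "\<And>t. t \<in> {0..e} \<Longrightarrow> (F ^^ n) (x + \<sigma> * t) = (F ^^ n) x + \<tau> * L ^ n * t"
    and 2: "\<And>t. t \<in> {0..e} \<Longrightarrow>
      v ((F ^^ n) (x + \<sigma> * t)) - v ((F ^^ n) x) = \<sigma> * \<tau> * m ^ n * (v (x + \<sigma> * t) - v x)"
    by blast
  obtain e' \<tau>' where e': "e' > 0" "\<tau>' \<in> {-1, 1}" and r: "ray_affine F L ((F ^^ n) x) \<tau> \<tau>' e'"
    using loc e(2) unfolding locally_affine_def by blast
  define d where "d = min e (e' / L ^ n)"
  have d: "d > 0" using e e' L by (simp add: d_def)
  have "(F ^^ Suc n) (x + \<sigma> * t) = (F ^^ Suc n) x + \<tau>' * L ^ Suc n * t \<and>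
    v ((F ^^ Suc n) (x + \<sigma> * t)) - v ((F ^^ Suc n) x) = \<sigma> * \<tau>' * m ^ Suc n * (v (x + \<sigma> * t) - v x)"
    if t: "t \<in> {0..d}" for t
  proof -
    have te: "t \<in> {0..e}" using t by (auto simp: d_def)
    have "t \<le> e' / L ^ n" using t by (auto simp: d_def)
    then have Lt: "L ^ n * t \<in> {0..e'}" using t L by (auto simp: field_simps)
    have eq: "(F ^^ n) (x + \<sigma> * t) = (F ^^ n) x + \<tau> * (L ^ n * t)"
      using 1[OF te] by (simp add: mult.assoc)
    have a: "(F ^^ Suc n) (x + \<sigma> * t) = (F ^^ Suc n) x + \<tau>' * L ^ Suc n * t"
      using r Lt by (simp add: eq ray_affine_def mult.assoc)
    have "v (F ((F ^^ n) x + \<tau> * (L ^ n * t))) - v (F ((F ^^ n) x))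
       = \<tau> * \<tau>' * m * (v ((F ^^ n) x + \<tau> * (L ^ n * t)) - v ((F ^^ n) x))"
      using Lt e(2) e'(2) by (intro conformalD[OF conf] ray_affine_mono[OF r]) auto
    then have "v ((F ^^ Suc n) (x + \<sigma> * t)) - v ((F ^^ Suc n) x) =
        \<tau> * \<tau>' * m * (\<sigma> * \<tau> * m ^ n * (v (x + \<sigma> * t) - v x))"
      using 2[OF te] by (simp add: eq)
    moreover have "\<tau> * \<tau> = 1" using e(2) by auto
    then have "\<tau> * \<tau>' * m * (\<sigma> * \<tau> * m ^ n * (v (x + \<sigma> * t) - v x)) =
        \<sigma> * \<tau>' * m ^ Suc n * (v (x + \<sigma> * t) - v x)"
      by (simp add: mult_ac)
    ultimately show ?thesis using a by simp
  qed
  then show ?case using d e'(2) by blast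
qed

lemma conformal_const: "conformal G L m (\<lambda>_. c)"
  by (simp add: conformal_def)

lemma locally_affine_funpow:
  assumes "L > 0" "locally_affine F L"
  shows "locally_affine (F ^^ n) (L ^ n)"
  using funpow_local[OF assms conformal_const[of F L 1 0]]
  unfolding locally_affine_def ray_affine_def by meson

text \<open>A segment on which the iterate is affine may be longer than those of
  \<open>funpow_local\<close>. The local statements are glued: the defect \<open>w\<close> is
  locally constant along the segment.\<close>

lemma conformal_funpow:
  assumes L: "L > 0" and loc: "locally_affine F L" and conf: "conformal F L m v"
  shows "conformal (F ^^ n) (L ^ n) (m ^ n) v"
  unfolding conformal_def
proof (intro allI ballI impI)
  fix x e \<sigma> \<tau> :: real
  assume \<sigma>: "\<sigma> \<in> {-1, 1}" and \<tau>: "\<tau> \<in> {-1, 1}" and e: "0 \<le> e"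
    and r: "ray_affine (F ^^ n) (L ^ n) x \<sigma> \<tau> e"
  define w where "w t = v ((F ^^ n) (x + \<sigma> * t)) - \<sigma> * \<tau> * m ^ n * v (x + \<sigma> * t)" for t
  have ray: "(F ^^ n) (x + \<sigma> * t) = (F ^^ n) x + \<tau> * L ^ n * t" if "t \<in> {0..e}" for t
    using r that by (auto simp: ray_affine_def)
  have side: "\<exists>d>0. \<forall>t\<in>{0..d}. t0 + \<rho> * t \<in> {0..e} \<longrightarrow> w t0 = w (t0 + \<rho> * t)"
    if t0: "t0 \<in> {0..e}" and \<rho>: "\<rho> \<in> {-1, 1}" for t0 \<rho>
  proof -
    have "\<sigma> * \<rho> \<in> {-1, 1}" using \<sigma> \<rho> by auto
    from funpow_local[OF L loc conf this, where x = "x + \<sigma> * t0" and n = n]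
    obtain d \<tau>' where d: "d > 0" "\<tau>' \<in> {-1, 1}"
      and 1: "\<And>t. t \<in> {0..d} \<Longrightarrow> (F ^^ n) (x + \<sigma> * t0 + \<sigma> * \<rho> * t) = (F ^^ n) (x + \<sigma> * t0) + \<tau>' * L ^ n * t"
      and 2: "\<And>t. t \<in> {0..d} \<Longrightarrow>
        v ((F ^^ n) (x + \<sigma> * t0 + \<sigma> * \<rho> * t)) - v ((F ^^ n) (x + \<sigma> * t0)) =
        \<sigma> * \<rho> * \<tau>' * m ^ n * (v (x + \<sigma> * t0 + \<sigma> * \<rho> * t) - v (x + \<sigma> * t0))"
      by metis
    have "w t0 = w (t0 + \<rho> * t)" if t: "t \<in> {0..d}" "t0 + \<rho> * t \<in> {0..e}" for t
    proof (cases "t = 0")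
      case False
      have eq: "x + \<sigma> * t0 + \<sigma> * \<rho> * t = x + \<sigma> * (t0 + \<rho> * t)" by (simp add: algebra_simps)
      have "\<tau>' * L ^ n * t = \<tau> * \<rho> * L ^ n * t"
        using 1[OF t(1)] ray[OF t(2)] ray[OF t0] unfolding eq by (simp add: algebra_simps)
      \<comment> \<open>Up to the direction \<open>\<rho>\<close> of travel, the local direction
        agrees with the one prescribed on the whole segment, hence so do the two multipliers of
        increments.\<close>
      then have \<tau>': "\<tau>' = \<tau> * \<rho>" using False L by simp
      have "\<rho> * \<rho> = 1" using \<rho> by auto
      then have "\<sigma> * \<rho> * \<tau>' = \<sigma> * \<tau>" unfolding \<tau>' by (simp add: mult_ac)
      then have "v ((F ^^ n) (x + \<sigma> * (t0 + \<rho> * t))) - v ((F ^^ n) (x + \<sigma> * t0)) =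
        \<sigma> * \<tau> * m ^ n * (v (x + \<sigma> * (t0 + \<rho> * t)) - v (x + \<sigma> * t0))"
        using 2[OF t(1)] unfolding eq by simp
      then show ?thesis by (simp add: w_def right_diff_distrib)
    qed simp
    then show ?thesis using d(1) by blast
  qed
  have "w 0 = w e"
    using side e by (intro interval_local_const[of 0 e w]) auto
  then show "v ((F ^^ n) (x + \<sigma> * e)) - v ((F ^^ n) x) = \<sigma> * \<tau> * m ^ n * (v (x + \<sigma> * e) - v x)"
    by (simp add: w_def algebra_simps)
qed

text \<open>Locally, each increment of \<open>v\<close> along the image is a multiple of an
  increment of \<open>v\<close> on \<open>{a..b}\<close>, hence 0. Turning points of the iterate do
  no harm, as the argument is one-sided.\<close>

lemma conformal_const_image:
  assumes "L > 0" "locally_affine F L" "conformal F L m v"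
    and const: "\<And>x. x \<in> {a..b} \<Longrightarrow> v x = c"
    and xy: "x \<in> {a..b}" "y \<in> {a..b}"
  shows "v ((F ^^ n) x) = v ((F ^^ n) y)"
proof (rule interval_local_const[of a b "\<lambda>x. v ((F ^^ n) x)", OF _ xy])
  fix x \<rho> :: real assume x: "x \<in> {a..b}" and \<rho>: "\<rho> \<in> {-1, 1}"
  obtain d \<tau> where d: "d > 0" "\<forall>t\<in>{0..d}.
      v ((F ^^ n) (x + \<rho> * t)) - v ((F ^^ n) x) = \<rho> * \<tau> * m ^ n * (v (x + \<rho> * t) - v x)"
    using funpow_local[OF assms(1-3) \<rho>, of n x] by blast
  then show "\<exists>d>0. \<forall>t\<in>{0..d}. x + \<rho> * t \<in> {a..b} \<longrightarrow> v ((F ^^ n) x) = v ((F ^^ n) (x + \<rho> * t))"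
    using const x by (intro exI[of _ d]) fastforce
qed

section \<open>Uniform splitting and transitivity\<close>

lemma degree_one_of_int:
  fixes G :: "real \<Rightarrow> real"
  assumes per: "\<And>x. G (x + 1) = G x + 1"
  shows "G (x + of_int k) = G x + of_int k"
proof (induction k rule: int_induct[where k = 0])
  case (step1 i)
  then show ?case using per[of "x + of_int i"] by (simp add: add.assoc)
next
  case (step2 i)
  then show ?case using per[of "x + of_int (i - 1)"] by (simp add: algebra_simps)
qed simp

lemma degree_one_funpow:
  fixes F :: "real \<Rightarrow> real"
  assumes per: "\<And>x. F (x + 1) = F x + 1"
  shows "(F ^^ n) (x + 1) = (F ^^ n) x + 1"
  by (induction n) (simp_all add: per)

text \<open>Degenerate segments are allowed, so the cut point \<open>c\<close> may be an endpoint.\<close>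
definition splits :: "(real \<Rightarrow> real) \<Rightarrow> real \<Rightarrow> real \<Rightarrow> bool" where
  "splits G L \<delta> \<longleftrightarrow> (\<forall>a b. a \<le> b \<and> b \<le> a + \<delta> \<longrightarrow>
    (\<exists>c\<in>{a..b}. (\<exists>\<tau>\<in>{-1, 1}. ray_affine G L c 1 \<tau> (b - c)) \<and>
                (\<exists>\<tau>\<in>{-1, 1}. ray_affine G L c (-1) \<tau> (c - a))))"

text \<open>Near each \<open>z\<close> only \<open>z\<close> itself can be a turning point. A
  Lebesgue number for these neighbourhoods on \<open>{0..1}\<close> works on the whole line after
  integer translations.\<close>

lemma uniform_splits:
  assumes loc: "locally_affine G L" and per: "\<And>x. G (x + 1) = G x + 1"
  obtains \<delta> where "\<delta> > 0" "splits G L \<delta>"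
proof -
  have "\<exists>e>0. (\<exists>\<tau>\<in>{-1, 1}. ray_affine G L x 1 \<tau> e) \<and> (\<exists>\<tau>\<in>{-1, 1}. ray_affine G L x (-1) \<tau> e)" for x
  proof -
    obtain e \<tau> where 1: "e > 0" "\<tau> \<in> {-1, 1}" "ray_affine G L x 1 \<tau> e"
      using loc unfolding locally_affine_def by blast
    obtain e' \<tau>' where 2: "e' > 0" "\<tau>' \<in> {-1, 1}" "ray_affine G L x (-1) \<tau>' e'"
      using loc unfolding locally_affine_def by blast
    show ?thesis
      using 1 2 ray_affine_mono[OF 1(3), of "min e e'"] ray_affine_mono[OF 2(3), of "min e e'"]
      by (intro exI[of _ "min e e'"]) auto
  qed
  then obtain e where e: "\<And>x. e x > 0"
    and r: "\<And>x. \<exists>\<tau>\<in>{-1, 1}. ray_affine G L x 1 \<tau> (e x)"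
    and l: "\<And>x. \<exists>\<tau>\<in>{-1, 1}. ray_affine G L x (-1) \<tau> (e x)"
    by metis
  have "\<exists>d>0. \<forall>x\<in>{0..1}. \<exists>B\<in>range (\<lambda>x. ball x (e x)). ball x d \<subseteq> B"
  proof (rule Heine_Borel_lemma)
    show "{0..1} \<subseteq> \<Union>(range (\<lambda>x. ball x (e x)))"
    proof
      fix x show "x \<in> \<Union>(range (\<lambda>x. ball x (e x)))" using e[of x] by (intro UN_I[of x]) auto
    qed
  qed auto
  then obtain d where d: "d > 0" "\<And>x. x \<in> {0..1} \<Longrightarrow> \<exists>z. ball x d \<subseteq> ball z (e z)"
    by fastforce
  \<comment> \<open>Length at most \<open>d / 2\<close> keeps \<open>b\<close> inside the open ball
    of radius \<open>d\<close> about \<open>a\<close>.\<close>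
  have "\<exists>c\<in>{a..b}. (\<exists>\<tau>\<in>{-1, 1}. ray_affine G L c 1 \<tau> (b - c)) \<and>
                (\<exists>\<tau>\<in>{-1, 1}. ray_affine G L c (-1) \<tau> (c - a))"
    if ab: "a \<le> b" "b \<le> a + d / 2" for a b
  proof -
    define k where "k = \<lfloor>a\<rfloor>"
    have "a - of_int k \<in> {0..1}" unfolding k_def atLeastAtMost_iff by linarith
    from d(2)[OF this] obtain z0 where z0: "ball (a - of_int k) d \<subseteq> ball z0 (e z0)" by blast
    have Gk: "G (x + of_int k) = G x + of_int k" for x
      by (rule degree_one_of_int[of G, OF per])
    have in_ball: "a - of_int k \<in> ball z0 (e z0)" "b - of_int k \<in> ball z0 (e z0)"
      using z0 ab d(1) by (auto simp: subset_eq dist_real_def)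
    define z where "z = z0 + of_int k"
    have az: "\<bar>a - z\<bar> < e z0" "\<bar>b - z\<bar> < e z0"
      using in_ball by (auto simp: z_def dist_real_def)
    have ray: "ray_affine G L z \<sigma> \<tau> (e z0)" if "ray_affine G L z0 \<sigma> \<tau> (e z0)" for \<sigma> \<tau>
      unfolding ray_affine_def
    proof
      fix t assume "t \<in> {0..e z0}"
      then have "G (z0 + \<sigma> * t) = G z0 + \<tau> * L * t" using that by (simp add: ray_affine_def)
      then show "G (z + \<sigma> * t) = G z + \<tau> * L * t"
        using Gk[of "z0 + \<sigma> * t"] Gk[of z0] by (simp add: z_def algebra_simps)
    qed
    obtain \<tau> where \<tau>: "\<tau> \<in> {-1, 1}" "ray_affine G L z 1 \<tau> (e z0)"
      using r[of z0] ray by blast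
    obtain \<tau>' where \<tau>': "\<tau>' \<in> {-1, 1}" "ray_affine G L z (-1) \<tau>' (e z0)"
      using l[of z0] ray by blast
    \<comment> \<open>If the centre lies outside \<open>{a..b}\<close>, the segment is on one side
      of it and an endpoint serves as the cut.\<close>
    consider "z < a" | "b < z" | "z \<in> {a..b}" by force
    then show ?thesis
    proof cases
      case 1
      have "G (a + t) = G a + \<tau> * L * t" if "t \<in> {0..b - a}" for t
      proof -
        have "G (z + 1 * (a - z + t)) = G z + \<tau> * L * (a - z + t)"
          "G (z + 1 * (a - z)) = G z + \<tau> * L * (a - z)"
          using that az 1 by (intro ray_affineD[OF \<tau>(2)]; simp)+
        then show ?thesis by (simp add: algebra_simps)
      qed
      then show ?thesis using ab \<tau>(1) by (intro bexI[of _ a]) (auto simp: ray_affine_def)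
    next
      case 2
      have "G (b - t) = G b + \<tau>' * L * t" if "t \<in> {0..b - a}" for t
      proof -
        have "G (z + -1 * (z - b + t)) = G z + \<tau>' * L * (z - b + t)"
          "G (z + -1 * (z - b)) = G z + \<tau>' * L * (z - b)"
          using that az 2 by (intro ray_affineD[OF \<tau>'(2)]; simp)+
        then show ?thesis by (simp add: algebra_simps)
      qed
      then show ?thesis using ab \<tau>'(1) by (intro bexI[of _ b]) (auto simp: ray_affine_def)
    next
      case 3
      have "b - z \<le> e z0" "z - a \<le> e z0" using az by auto
      then show ?thesis
        using 3 \<tau> \<tau>' by (intro bexI[of _ z]) (auto intro: ray_affine_mono)
    qed
  qed
  then have "splits G L (d / 2)" unfolding splits_def by blast
  with d(1) show thesis by (intro that[of "d / 2"]) auto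
qed

lemma ray_affine_image:
  assumes r: "ray_affine G L c \<sigma> \<tau> e" and \<tau>: "\<tau> \<in> {-1, 1}" and L: "L > 0"
    and d: "d \<le> L * e"
  shows "\<exists>y. {y..y + d} \<subseteq> G ` (\<lambda>t. c + \<sigma> * t) ` {0..e}"
proof (intro exI subsetI)
  fix z assume z: "z \<in> {(if \<tau> = 1 then G c else G c - d) .. (if \<tau> = 1 then G c else G c - d) + d}"
  define t where "t = \<tau> * (z - G c) / L"
  have "t \<in> {0..e}" using z \<tau> L d by (auto simp: t_def field_simps split: if_splits)
  moreover have "\<tau> * \<tau> = 1" using \<tau> by auto
  then have "\<tau> * L * t = z - G c" using L by (simp add: t_def)
  ultimately have "z = G (c + \<sigma> * t)" using r by (simp add: ray_affine_def)
  with \<open>t \<in> _\<close> show "z \<in> G ` (\<lambda>t. c + \<sigma> * t) ` {0..e}" by blast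
qed

text \<open>One of the two affine pieces has length at least \<open>d / 2\<close> and is stretched
  by at least 2, so folding loses no length.\<close>

lemma splits_expand:
  assumes sp: "splits G L \<delta>" and L: "L \<ge> 2" and d: "0 < d" "d \<le> \<delta>" and sub: "{y..y + d} \<subseteq> S"
  shows "\<exists>z. {z..z + d} \<subseteq> G ` S"
proof -
  obtain c where c: "c \<in> {y..y + d}"
    and r: "\<exists>\<tau>\<in>{-1, 1}. ray_affine G L c 1 \<tau> (y + d - c)"
    and l: "\<exists>\<tau>\<in>{-1, 1}. ray_affine G L c (-1) \<tau> (c - y)"
    using sp d unfolding splits_def by (meson add_increasing2 add_left_mono less_imp_le order_refl)
  have big: "d \<le> L * e" if "e \<ge> d / 2" for e
  proof -
    have "2 * (d / 2) \<le> L * e" using that L d by (intro mult_mono) auto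
    then show ?thesis by simp
  qed
  show ?thesis
  proof (cases "c - y \<ge> d / 2")
    case True
    obtain \<tau> where "\<tau> \<in> {-1, 1}" "ray_affine G L c (-1) \<tau> (c - y)" using l by blast
    then obtain z where "{z..z + d} \<subseteq> G ` (\<lambda>t. c + -1 * t) ` {0..c - y}"
      using ray_affine_image[of G L c "-1" \<tau> "c - y" d] big[OF True] L by auto
    moreover have "(\<lambda>t. c + -1 * t) ` {0..c - y} \<subseteq> S" using sub c by auto
    ultimately show ?thesis by (meson image_mono order_trans)
  next
    case False
    then have F: "y + d - c \<ge> d / 2" by argo
    obtain \<tau> where "\<tau> \<in> {-1, 1}" "ray_affine G L c 1 \<tau> (y + d - c)" using r by blast
    then obtain z where "{z..z + d} \<subseteq> G ` (\<lambda>t. c + 1 * t) ` {0..y + d - c}"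
      using ray_affine_image[of G L c "1" \<tau> "y + d - c" d] big[OF F] L by auto
    moreover have "(\<lambda>t. c + 1 * t) ` {0..y + d - c} \<subseteq> S" using sub c by auto
    ultimately show ?thesis by (meson image_mono order_trans)
  qed
qed

text \<open>By \<open>splits_expand\<close>, an iterate \<open>F ^^ N\<close> of slope above 2
  preserves small lengths. Division of \<open>n\<close> by \<open>N\<close> leaves finitely many
  initial images, whose lengths have a positive lower bound.\<close>

lemma funpow_images_long:
  assumes lam: "lam > 1" and loc: "locally_affine F lam" and per: "\<And>x. F (x + 1) = F x + 1"
    and ab: "a < b"
  obtains d where "d > 0" "\<And>n. \<exists>y. {y..y + d} \<subseteq> (F ^^ n) ` {a..b}"
proof -
  obtain N where N: "2 < lam ^ N" using real_arch_pow[OF lam] by blast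
  then have "N > 0" by (cases N) auto
  have "locally_affine (F ^^ N) (lam ^ N)" using locally_affine_funpow[OF _ loc] lam by simp
  from uniform_splits[OF this degree_one_funpow[of F, OF per]]
  obtain \<delta> where \<delta>: "\<delta> > 0" "splits (F ^^ N) (lam ^ N) \<delta>" by blast
  have one: "\<exists>d>0. \<exists>y. {y..y + d} \<subseteq> (F ^^ r) ` {a..b}" for r
  proof -
    obtain e \<tau> where e: "e > 0" "\<tau> \<in> {-1, 1}" and ray: "ray_affine (F ^^ r) (lam ^ r) a 1 \<tau> e"
      using locally_affine_funpow[OF _ loc, of r] lam unfolding locally_affine_def by force
    define e' where "e' = min e (b - a)"
    have "ray_affine (F ^^ r) (lam ^ r) a 1 \<tau> e'" using ray by (rule ray_affine_mono) (simp add: e'_def)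
    from ray_affine_image[OF this e(2), of "lam ^ r * e'"] lam
    obtain y where "{y..y + lam ^ r * e'} \<subseteq> (F ^^ r) ` (\<lambda>t. a + 1 * t) ` {0..e'}"
      by auto
    moreover have "(\<lambda>t. a + 1 * t) ` {0..e'} \<subseteq> {a..b}" by (auto simp: e'_def)
    ultimately have "{y..y + lam ^ r * e'} \<subseteq> (F ^^ r) ` {a..b}" by (meson image_mono order_trans)
    moreover have "lam ^ r * e' > 0" using lam e ab by (simp add: e'_def)
    ultimately show ?thesis by blast
  qed
  have "\<exists>d>0. \<forall>r<M. \<exists>y. {y..y + d} \<subseteq> (F ^^ r) ` {a..b}" for M
  proof (induction M)
    case (Suc M)
    then obtain d where d: "d > 0" "\<And>r. r < M \<Longrightarrow> \<exists>y. {y..y + d} \<subseteq> (F ^^ r) ` {a..b}" by blast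
    obtain d' where d': "d' > 0" "\<exists>y. {y..y + d'} \<subseteq> (F ^^ M) ` {a..b}" using one by blast
    have sub: "{y..y + min d d'} \<subseteq> {y..y + d}" "{y..y + min d d'} \<subseteq> {y..y + d'}" for y :: real by auto
    have "\<exists>y. {y..y + min d d'} \<subseteq> (F ^^ r) ` {a..b}" if "r < Suc M" for r
    proof (cases "r = M")
      case True then show ?thesis using d'(2) sub(2) by (meson order_trans)
    next
      case False then show ?thesis using d(2)[of r] sub(1) that by (meson order_trans less_SucE)
    qed
    then show ?case using d d' by (intro exI[of _ "min d d'"]) auto
  qed (auto intro: exI[of _ 1])
  then obtain d where d: "d > 0" "\<And>r. r < N \<Longrightarrow> \<exists>y. {y..y + d} \<subseteq> (F ^^ r) ` {a..b}" by blast
  \<comment> \<open>\<open>splits_expand\<close> covers only lengths up to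
    \<open>\<delta>\<close>.\<close>
  define d' where "d' = min d \<delta>"
  have "\<exists>y. {y..y + d'} \<subseteq> (F ^^ n) ` {a..b}" for n
  proof -
    define r where "r = n mod N"
    have "\<exists>y. {y..y + d'} \<subseteq> ((F ^^ N) ^^ q) ` (F ^^ r) ` {a..b}" for q
    proof (induction q)
      case 0
      obtain y where "{y..y + d} \<subseteq> (F ^^ r) ` {a..b}" using d(2)[of r] \<open>N > 0\<close> by (auto simp: r_def)
      moreover have "{y..y + d'} \<subseteq> {y..y + d}" by (auto simp: d'_def)
      ultimately have "{y..y + d'} \<subseteq> (F ^^ r) ` {a..b}" by (rule order_trans[rotated])
      then show ?case by auto
    next
      case (Suc q)
      then obtain y where "{y..y + d'} \<subseteq> ((F ^^ N) ^^ q) ` (F ^^ r) ` {a..b}" by blast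
      from splits_expand[OF \<delta>(2) _ _ _ this] N d(1) \<delta>(1)
      have "\<exists>z. {z..z + d'} \<subseteq> (F ^^ N) ` ((F ^^ N) ^^ q) ` (F ^^ r) ` {a..b}"
        by (simp add: d'_def)
      then show ?case by (simp add: image_comp comp_assoc)
    qed
    moreover have "(F ^^ n) = ((F ^^ N) ^^ (n div N)) \<circ> (F ^^ r)"
      by (simp add: r_def funpow_mult flip: funpow_add)
    ultimately show ?thesis by (metis image_comp)
  qed
  then show thesis using d(1) \<delta>(1) by (intro that[of d']) (auto simp: d'_def)
qed

text \<open>The images of \<open>{a..b}\<close> are dense and have length at least \<open>d\<close>, so an image meeting a shorter
  interval \<open>{x..y}\<close> contains \<open>x\<close> or \<open>y\<close>; hence \<open>v\<close> cannot take intermediate values on \<open>{x..y}\<close>.\<close>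
lemma conformal_const_spread:
  assumes lam: "lam > 1" and loc: "locally_affine F lam" and per: "\<And>x. F (x + 1) = F x + 1"
    and cF: "continuous_on UNIV F" and trans: "topologically_transitive F"
    and conf: "conformal F lam m v" and cv: "continuous_on UNIV v"
    and ab: "a < b" and const: "\<And>x. x \<in> {a..b} \<Longrightarrow> v x = c"
  shows "v p = v q"
proof -
  obtain d where d: "d > 0" "\<And>n. \<exists>y. {y..y + d} \<subseteq> (F ^^ n) ` {a..b}"
    using funpow_images_long[OF lam loc per ab] by blast
  have cFn: "continuous_on UNIV (F ^^ n)" for n
  proof (induction n)
    case (Suc n)
    then show ?case using continuous_on_compose[OF Suc continuous_on_subset[OF cF]] by simp
  qed (simp add: continuous_on_id)
  have near: "v x = v y" if xy: "x < y" "y < x + d" for x y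
  proof (rule ccontr)
    assume ne: "v x \<noteq> v y"
    have cont: "continuous_on {x..y} v" by (rule continuous_on_subset[OF cv]) simp
    obtain z where z: "z \<in> {x..y}" "v z = (v x + v y) / 2"
    proof (cases "v x \<le> v y")
      case True
      then show thesis using IVT'[of v x "(v x + v y) / 2" y] cont xy that by fastforce
    next
      case False
      then show thesis using IVT2'[of v y "(v x + v y) / 2" x] cont xy that by fastforce
    qed
    \<comment> \<open>The intermediate value at \<open>z\<close> makes \<open>W\<close> nonempty, so
      by transitivity some image of \<open>{a<..<b}\<close> meets it.\<close>
    define W where "W = {x<..<y} \<inter> v -` (- {v x, v y})"
    have "open W" unfolding W_def
      by (intro open_Int open_vimage cv) (auto intro: finite_imp_closed simp: open_Compl)
    moreover have "z \<in> W"
      using z ne by (auto simp: W_def less_le field_simps)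
    ultimately obtain n where "(F ^^ n) ` {a<..<b} \<inter> W \<noteq> {}"
      using trans ab unfolding topologically_transitive_def
      by (metis empty_iff greaterThanLessThan_empty_iff leD open_greaterThanLessThan)
    then obtain p where p: "p \<in> {a..b}" "(F ^^ n) p \<in> W" by fastforce
    obtain y0 where y0: "{y0..y0 + d} \<subseteq> (F ^^ n) ` {a..b}" using d(2) by blast
    have "connected ((F ^^ n) ` {a..b})"
      by (intro connected_continuous_image continuous_on_subset[OF cFn]) auto
    then have ivl: "is_interval ((F ^^ n) ` {a..b})" by (simp add: is_interval_connected_1)
    have in_W: "(F ^^ n) p \<in> (F ^^ n) ` {a..b}" "y0 \<in> (F ^^ n) ` {a..b}" "y0 + d \<in> (F ^^ n) ` {a..b}"
      using p(1) y0 d(1) by auto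
    have "x \<in> (F ^^ n) ` {a..b} \<or> y \<in> (F ^^ n) ` {a..b}"
    proof (cases "y0 \<le> x")
      case True
      have "x \<le> (F ^^ n) p" using p(2) by (auto simp: W_def)
      with True ivl in_W show ?thesis unfolding is_interval_1 by blast
    next
      case False
      then have "(F ^^ n) p \<le> y" "y \<le> y0 + d" using p(2) xy by (auto simp: W_def)
      with ivl in_W show ?thesis unfolding is_interval_1 by blast
    qed
    then have "v ((F ^^ n) p) = v x \<or> v ((F ^^ n) p) = v y"
      using conformal_const_image[OF _ loc conf const] p(1) lam by (smt (verit) imageE)
    with p(2) show False by (auto simp: W_def)
  qed
  show ?thesis
  proof (rule connected_local_const[of UNIV p q v])
    show "\<forall>x\<in>UNIV. eventually (\<lambda>y. v x = v y) (at x)"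
    proof
      fix x
      have "v x = v y" if "dist y x < d" for y
      proof (cases x y rule: linorder_cases)
        case less
        then show ?thesis using near that by (simp add: dist_real_def)
      next
        case greater
        then show ?thesis using near[of y x] that by (simp add: dist_real_def)
      qed simp
      then show "eventually (\<lambda>y. v x = v y) (at x)" unfolding eventually_at using d(1) by blast
    qed
  qed auto
qed

section \<open>Growth of increments\<close>

text \<open>Cut \<open>{a..b}\<close> into at most \<open>(b - a) / \<delta> + 1\<close> segments of
  length at most \<open>\<delta>\<close>, and each of these into two affine pieces. The hypothesis
  is applied to the image of each piece, which is \<open>L\<close> times as long, at the price of
  one \<open>\<alpha>\<close> per piece.\<close>

lemma growth_step:
  assumes sp: "splits G L \<delta>" and \<delta>: "\<delta> > 0" and L: "L > 0" and conf: "conformal G L m v"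
    and \<alpha>: "\<alpha> \<ge> 0" and bd: "\<And>a b. a \<le> b \<Longrightarrow> v b - v a \<le> \<alpha> + \<beta> * (b - a)" and ab: "a \<le> b"
  shows "m * (v b - v a) \<le> 2 * \<alpha> + (L * \<beta> + 2 * \<alpha> / \<delta>) * (b - a)"
proof -
  \<comment> \<open>The signs orient both increments from left to right, so that the bound applies
    to the image.\<close>
  have piece: "m * \<sigma> * (v (c + \<sigma> * e) - v c) \<le> \<alpha> + L * \<beta> * e"
    if "ray_affine G L c \<sigma> \<tau> e" "\<sigma> \<in> {-1, 1}" "\<tau> \<in> {-1, 1}" "e \<ge> 0" for c \<sigma> \<tau> e
  proof -
    have "v (G (c + \<sigma> * e)) - v (G c) = \<sigma> * \<tau> * m * (v (c + \<sigma> * e) - v c)"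
      by (rule conformalD[OF conf that])
    moreover have "G (c + \<sigma> * e) = G c + \<tau> * (L * e)" using that by (simp add: ray_affine_def)
    moreover have "\<tau> * (v (G c + \<tau> * (L * e)) - v (G c)) \<le> \<alpha> + \<beta> * (L * e)"
      using that(3,4) bd[of "G c" "G c + L * e"] bd[of "G c - L * e" "G c"] L by auto
    moreover have "\<tau> * \<tau> = 1" using that(3) by auto
    ultimately show ?thesis by (simp add: mult_ac) (simp flip: mult.assoc)
  qed
  have short: "m * (v b - v a) \<le> 2 * \<alpha> + L * \<beta> * (b - a)" if "a \<le> b" "b \<le> a + \<delta>" for a b
  proof -
    obtain c \<tau> \<tau>' where c: "c \<in> {a..b}" "\<tau> \<in> {-1, 1}" "ray_affine G L c 1 \<tau> (b - c)"
      "\<tau>' \<in> {-1, 1}" "ray_affine G L c (-1) \<tau>' (c - a)"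
      using sp \<open>a \<le> b\<close> \<open>b \<le> a + \<delta>\<close> unfolding splits_def by blast
    have "m * (v b - v c) \<le> \<alpha> + L * \<beta> * (b - c)"
      using piece[OF c(3) _ c(2)] c(1) by simp
    moreover have "m * (v c - v a) \<le> \<alpha> + L * \<beta> * (c - a)"
      using piece[OF c(5) _ c(4)] c(1) by (simp add: algebra_simps)
    ultimately show ?thesis by (simp add: algebra_simps)
  qed
  have long: "b \<le> a + real (Suc q) * \<delta> \<Longrightarrow> a \<le> b \<Longrightarrow>
      m * (v b - v a) \<le> 2 * real (Suc q) * \<alpha> + L * \<beta> * (b - a)" for q a
  proof (induction q arbitrary: a)
    case 0 then show ?case using short[of a b] by simp
  next
    case (Suc q)
    show ?case
    proof (cases "b \<le> a + \<delta>")
      case True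
      then have "m * (v b - v a) \<le> 2 * \<alpha> + L * \<beta> * (b - a)" using short Suc.prems by simp
      moreover have "2 * \<alpha> \<le> 2 * real (Suc (Suc q)) * \<alpha>" using mult_right_mono[of 2 "2 * real (Suc (Suc q))" \<alpha>] \<alpha> by simp
      ultimately show ?thesis by linarith
    next
      case False
      then have "m * (v b - v (a + \<delta>)) \<le> 2 * real (Suc q) * \<alpha> + L * \<beta> * (b - (a + \<delta>))"
        using Suc.prems by (intro Suc.IH) (auto simp: algebra_simps)
      moreover have "m * (v (a + \<delta>) - v a) \<le> 2 * \<alpha> + L * \<beta> * \<delta>" using short[of a "a + \<delta>"] \<delta> by simp
      ultimately show ?thesis by (simp add: algebra_simps)
    qed
  qed
  define q where "q = nat \<lfloor>(b - a) / \<delta>\<rfloor>"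
  have q: "real q \<le> (b - a) / \<delta>" "(b - a) / \<delta> \<le> real (Suc q)"
  proof -
    have "(b - a) / \<delta> \<ge> 0" using ab \<delta> by simp
    then show "real q \<le> (b - a) / \<delta>" "(b - a) / \<delta> \<le> real (Suc q)"
      unfolding q_def by linarith+
  qed
  have "m * (v b - v a) \<le> 2 * real (Suc q) * \<alpha> + L * \<beta> * (b - a)"
    using q(2) \<delta> ab by (intro long) (auto simp: field_simps)
  moreover have "2 * real (Suc q) * \<alpha> \<le> 2 * ((b - a) / \<delta> + 1) * \<alpha>"
    using q(1) \<alpha> by (intro mult_right_mono mult_left_mono) auto
  moreover have "2 * ((b - a) / \<delta> + 1) * \<alpha> + L * \<beta> * (b - a) = 2 * \<alpha> + (L * \<beta> + 2 * \<alpha> / \<delta>) * (b - a)"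
    by (simp add: algebra_simps add_divide_distrib diff_divide_distrib)
  ultimately show ?thesis by linarith
qed

text \<open>Here \<open>\<beta>\<close> may be negative: applied to \<open>- v\<close> this is a lower bound for the growth.\<close>
lemma growth:
  assumes sp: "splits G L \<delta>" and \<delta>: "\<delta> > 0" and L: "L > 2" and conf: "conformal G L m v"
    and \<alpha>: "\<alpha> \<ge> 0" and bd: "\<And>a b. a \<le> b \<Longrightarrow> v b - v a \<le> \<alpha> + \<beta> * (b - a)" and ab: "a \<le> b"
  shows "m ^ n * (v b - v a) \<le>
    2 ^ n * \<alpha> + (L ^ n * \<beta> + 2 * \<alpha> / (\<delta> * (L - 2)) * (L ^ n - 2 ^ n)) * (b - a)"
  using ab
proof (induction n arbitrary: a b)
  case 0 then show ?case using bd by simp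
next
  case (Suc n)
  \<comment> \<open>\<open>growth_step\<close> is applied to \<open>m ^ n * v\<close> with additive
    error \<open>2 ^ n * \<alpha>\<close>. Each slope coefficient is \<open>L\<close> times the
    previous one plus \<open>2 ^ Suc n * \<alpha> / \<delta>\<close>; the geometric sum
    \<open>(L ^ n - 2 ^ n) / (L - 2)\<close> solves this recursion.\<close>
  have "m * (m ^ n * v b - m ^ n * v a) \<le> 2 * (2 ^ n * \<alpha>) +
      (L * (L ^ n * \<beta> + 2 * \<alpha> / (\<delta> * (L - 2)) * (L ^ n - 2 ^ n)) + 2 * (2 ^ n * \<alpha>) / \<delta>) * (b - a)"
    using L \<alpha> Suc.IH Suc.prems
    by (intro growth_step[OF sp \<delta> _ conformal_scale[OF conf]]) (auto simp: right_diff_distrib)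
  also have "L * (L ^ n * \<beta> + 2 * \<alpha> / (\<delta> * (L - 2)) * (L ^ n - 2 ^ n)) + 2 * (2 ^ n * \<alpha>) / \<delta>
     = L ^ Suc n * \<beta> + 2 * \<alpha> / (\<delta> * (L - 2)) * (L ^ Suc n - 2 ^ Suc n)"
    using L \<delta> by (simp add: divide_simps) (simp add: algebra_simps)
  finally have "m * (m ^ n * v b - m ^ n * v a) \<le> 2 * (2 ^ n * \<alpha>) +
    (L ^ Suc n * \<beta> + 2 * \<alpha> / (\<delta> * (L - 2)) * (L ^ Suc n - 2 ^ Suc n)) * (b - a)" .
  moreover have "m * (m ^ n * v b - m ^ n * v a) = m ^ Suc n * (v b - v a)" by (simp add: algebra_simps)
  moreover have "2 * (2 ^ n * \<alpha>) = 2 ^ Suc n * \<alpha>" by simp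
  ultimately show ?case by (simp only:)
qed

section \<open>Sums, translates and periodization of conformal functions\<close>

lemma conformal_add:
  assumes "conformal G L m v" "conformal G L m w"
  shows "conformal G L m (\<lambda>x. v x + w x)"
  unfolding conformal_def
proof (intro allI ballI impI)
  fix x e \<sigma> \<tau> :: real
  assume *: "\<sigma> \<in> {-1, 1}" "\<tau> \<in> {-1, 1}" "0 \<le> e" "ray_affine G L x \<sigma> \<tau> e"
  show "v (G (x + \<sigma> * e)) + w (G (x + \<sigma> * e)) - (v (G x) + w (G x)) =
      \<sigma> * \<tau> * m * (v (x + \<sigma> * e) + w (x + \<sigma> * e) - (v x + w x))"
    using conformalD[OF assms(1) *(4,1,2,3)] conformalD[OF assms(2) *(4,1,2,3)]
    by (simp add: distrib_left right_diff_distrib)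
qed

text \<open>Length is the model case, to be compared with \<open>v\<close> once both are known to
  grow at the same rate.\<close>

lemma conformal_id: "conformal G L L (\<lambda>x. x)"
proof -
  have "\<tau> = \<sigma> * \<tau> * \<sigma>" if "\<sigma> \<in> {-1, 1}" for \<sigma> \<tau> :: real using that by auto
  then show ?thesis by (auto simp: conformal_def ray_affine_def mult_ac)
qed

lemma conformal_translate:
  assumes per: "\<And>x. G (x + 1) = G x + 1" and conf: "conformal G L m v"
  shows "conformal G L m (\<lambda>x. v (x + of_int k))"
  unfolding conformal_def
proof (intro allI ballI impI)
  fix x e \<sigma> \<tau> :: real
  assume *: "\<sigma> \<in> {-1, 1}" "\<tau> \<in> {-1, 1}" "0 \<le> e" "ray_affine G L x \<sigma> \<tau> e"
  have G: "G (y + of_int k) = G y + of_int k" for y by (rule degree_one_of_int[of G, OF per])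
  have eq: "x + of_int k + \<sigma> * t = x + \<sigma> * t + of_int k" for t by simp
  have "ray_affine G L (x + of_int k) \<sigma> \<tau> e"
    using *(4) unfolding ray_affine_def eq by (simp add: G)
  from conformalD[OF conf this *(1-3)]
  show "v (G (x + \<sigma> * e) + of_int k) - v (G x + of_int k) =
      \<sigma> * \<tau> * m * (v (x + \<sigma> * e + of_int k) - v (x + of_int k))"
    unfolding eq by (simp add: G)
qed

lemma conformal_suminf:
  assumes conf: "\<And>n. conformal G L m (T n)" and sum: "\<And>x. summable (\<lambda>n. T n x)"
  shows "conformal G L m (\<lambda>x. \<Sum>n. T n x)"
  unfolding conformal_def
proof (intro allI ballI impI)
  fix x e \<sigma> \<tau> :: real
  assume *: "\<sigma> \<in> {-1, 1}" "\<tau> \<in> {-1, 1}" "0 \<le> e" "ray_affine G L x \<sigma> \<tau> e"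
  have "(\<Sum>n. T n (G (x + \<sigma> * e))) - (\<Sum>n. T n (G x)) = (\<Sum>n. T n (G (x + \<sigma> * e)) - T n (G x))"
    by (intro suminf_diff sum)
  also have "\<dots> = (\<Sum>n. \<sigma> * \<tau> * m * (T n (x + \<sigma> * e) - T n x))"
    by (intro suminf_cong conformalD[OF conf] *)
  also have "\<dots> = \<sigma> * \<tau> * m * (\<Sum>n. T n (x + \<sigma> * e) - T n x)"
    by (intro suminf_mult summable_diff sum)
  also have "(\<Sum>n. T n (x + \<sigma> * e) - T n x) = (\<Sum>n. T n (x + \<sigma> * e)) - (\<Sum>n. T n x)"
    by (intro suminf_diff[symmetric] sum)
  finally show "(\<Sum>n. T n (G (x + \<sigma> * e))) - (\<Sum>n. T n (G x)) =
    \<sigma> * \<tau> * m * ((\<Sum>n. T n (x + \<sigma> * e)) - (\<Sum>n. T n x))" .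
qed

text \<open>The series telescope, and a bounded monotone function has limits in both
  directions.\<close>

lemma summable_mono_increments:
  fixes v :: "real \<Rightarrow> real"
  assumes mono: "mono v" and bd: "\<And>x. \<bar>v x\<bar> \<le> B"
  shows "summable (\<lambda>n. v (x + real (Suc n)) - v (x + real n))"
    and "summable (\<lambda>n. v (x - real n) - v (x - real (Suc n)))"
proof -
  have "incseq (\<lambda>n. v (x + real n))" using mono by (auto simp: incseq_def intro: monoD)
  then obtain l where "(\<lambda>n. v (x + real n)) \<longlonglongrightarrow> l"
    using incseq_convergent[of "\<lambda>n. v (x + real n)" B] bd by (meson abs_le_D1)
  then show "summable (\<lambda>n. v (x + real (Suc n)) - v (x + real n))" by (rule telescope_summable)
  have "decseq (\<lambda>n. v (x - real n))" using mono by (auto simp: decseq_def intro: monoD)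
  then obtain l where "(\<lambda>n. v (x - real n)) \<longlonglongrightarrow> l"
    using decseq_convergent[of "\<lambda>n. v (x - real n)" "-B"] bd by (meson abs_le_D2 minus_le_iff)
  then show "summable (\<lambda>n. v (x - real n) - v (x - real (Suc n)))" by (rule telescope_summable')
qed

text \<open>Up to a constant, \<open>w\<close> is the sum of all integer translates of \<open>v\<close>.\<close>
lemma periodize:
  assumes mono: "mono v" and bd: "\<And>x. \<bar>v x\<bar> \<le> B"
    and per: "\<And>x. G (x + 1) = G x + 1" and conf: "conformal G L m v"
  obtains w where "conformal G L m w"
    and "\<And>a b k. a \<le> b \<Longrightarrow> v (b + of_int k) - v (a + of_int k) \<le> w b - w a"
proof -
  \<comment> \<open>The shifts \<open>n\<close> and \<open>- n - 1\<close> together run once through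
    all integers. The constant makes \<open>T n 0 = 0\<close>, since only increments of
    \<open>v\<close>, not its values, are summable.\<close>
  define T where "T n x = v (x + of_int (int n)) + v (x + of_int (- int n - 1))
    + (- v (real n) - v (- real n - 1))" for n :: nat and x
  have Tc: "conformal G L m (T n)" for n
    unfolding T_def by (intro conformal_add conformal_translate[of G, OF per conf] conformal_const)
  have T_mono: "T n a \<le> T n b" if "a \<le> b" for n a b
    using that monoD[OF mono] by (auto simp: T_def intro!: add_mono)
  have sum: "summable (\<lambda>n. T n x)" for x
  proof -
    define j where "j = nat \<lceil>\<bar>x\<bar>\<rceil>"
    have j: "\<bar>x\<bar> \<le> real j" unfolding j_def by linarith
    \<comment> \<open>A unit increment of \<open>T n\<close> is one forward and one backward
      increment of \<open>v\<close>.\<close>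
    have step: "summable (\<lambda>n. T n (z + 1) - T n z)" for z
    proof -
      have "summable (\<lambda>n. (v (z + real (Suc n)) - v (z + real n)) + (v (z - real n) - v (z - real (Suc n))))"
        by (intro summable_add summable_mono_increments[OF mono bd])
      also have "(\<lambda>n. (v (z + real (Suc n)) - v (z + real n)) + (v (z - real n) - v (z - real (Suc n))))
        = (\<lambda>n. T n (z + 1) - T n z)"
        by (auto simp: T_def algebra_simps)
      finally show ?thesis .
    qed
    \<comment> \<open>Unit steps from \<open>- j\<close> to \<open>j\<close> add up to a summable
      bound for the variation of \<open>T n\<close> on an interval containing both \<open>x\<close>
      and the zero 0 of \<open>T n\<close>.\<close>
    have "summable (\<lambda>n. \<Sum>i<2 * j. T n (- real j + real i + 1) - T n (- real j + real i))"
      by (intro summable_sum step)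
    also have "(\<lambda>n. \<Sum>i<2 * j. T n (- real j + real i + 1) - T n (- real j + real i))
      = (\<lambda>n. T n (real j) - T n (- real j))"
    proof
      fix n
      have "(\<Sum>i<2 * j. T n (- real j + real (Suc i)) - T n (- real j + real i)) = T n (real j) - T n (- real j)"
        by (subst sum_lessThan_telescope) simp
      then show "(\<Sum>i<2 * j. T n (- real j + real i + 1) - T n (- real j + real i)) = T n (real j) - T n (- real j)"
        by (simp add: add_ac)
    qed
    finally have major: "summable (\<lambda>n. T n (real j) - T n (- real j))" .
    have "norm (T n x) \<le> T n (real j) - T n (- real j)" for n
    proof -
      have "T n 0 = 0" by (simp add: T_def)
      then show ?thesis
        using T_mono[of "- real j" x n] T_mono[of x "real j" n] T_mono[of "- real j" 0 n]
          T_mono[of 0 "real j" n] j by (simp add: abs_le_iff)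
    qed
    then show ?thesis by (rule summable_comparison_test'[OF major])
  qed
  define w where "w x = (\<Sum>n. T n x)" for x
  have "conformal G L m w" unfolding w_def by (intro conformal_suminf Tc sum)
  moreover have "v (b + of_int k) - v (a + of_int k) \<le> w b - w a" if ab: "a \<le> b" for a b k
  proof -
    \<comment> \<open>The index of the term containing the shift by \<open>k\<close>; the other
      shift in it and all other terms have nonnegative increments.\<close>
    define n where "n = nat (if k \<ge> 0 then k else - k - 1)"
    have "v (b + of_int k) - v (a + of_int k) \<le> T n b - T n a"
    proof (cases "k \<ge> 0")
      case True
      then have "k = int n" by (simp add: n_def)
      then show ?thesis using monoD[OF mono, of "a + of_int (- int n - 1)" "b + of_int (- int n - 1)"] ab
        by (simp add: T_def)
    next
      case False
      then have "k = - int n - 1" by (simp add: n_def)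
      then show ?thesis using monoD[OF mono, of "a + of_int (int n)" "b + of_int (int n)"] ab
        by (simp add: T_def)
    qed
    also have "\<dots> \<le> (\<Sum>n. T n b - T n a)"
      using sum_le_suminf[of "\<lambda>n. T n b - T n a" "{n}"] T_mono[OF ab] by (simp add: summable_diff sum)
    also have "\<dots> = w b - w a" unfolding w_def by (intro suminf_diff[symmetric] sum)
    finally show ?thesis .
  qed
  ultimately show thesis by (rule that)
qed

text \<open>Steps of length exactly \<open>\<delta>\<close> obey the sharp bound, so
  \<open>\<alpha>\<close> is paid only once, on the last short segment.\<close>

lemma bound_from_short:
  fixes v :: "real \<Rightarrow> real"
  assumes \<delta>: "\<delta> > 0" and step: "\<And>x. v (x + \<delta>) - v x \<le> \<beta> * \<delta>"
    and short: "\<And>a b. a \<le> b \<Longrightarrow> b \<le> a + \<delta> \<Longrightarrow> v b - v a \<le> \<alpha> + \<beta> * (b - a)" and ab: "a \<le> b"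
  shows "v b - v a \<le> \<alpha> + \<beta> * (b - a)"
proof -
  have long: "b \<le> a + real (Suc q) * \<delta> \<Longrightarrow> a \<le> b \<Longrightarrow> v b - v a \<le> \<alpha> + \<beta> * (b - a)" for q a
  proof (induction q arbitrary: a)
    case 0 then show ?case using short by simp
  next
    case (Suc q)
    show ?case
    proof (cases "b \<le> a + \<delta>")
      case True then show ?thesis using short Suc.prems by simp
    next
      case False
      then have "v b - v (a + \<delta>) \<le> \<alpha> + \<beta> * (b - (a + \<delta>))"
        using Suc.prems by (intro Suc.IH) (auto simp: algebra_simps)
      then show ?thesis using step[of a] by (simp add: algebra_simps)
    qed
  qed
  obtain q where "(b - a) / \<delta> \<le> real q" using real_arch_simple by blast
  then have "b \<le> a + real (Suc q) * \<delta>" using \<delta> by (simp add: field_simps)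
  then show ?thesis using ab by (rule long)
qed

text \<open>Divide \<open>growth\<close> by \<open>L ^ n\<close> and let \<open>n\<close> tend to
  infinity: the additive error vanishes at the cost of a larger slope.\<close>

lemma growth_limit:
  assumes sp: "splits G L \<delta>" and \<delta>: "\<delta> > 0" and L: "L > 2" and conf: "conformal G L L v"
    and \<alpha>: "\<alpha> \<ge> 0" and bd: "\<And>a b. a \<le> b \<Longrightarrow> v b - v a \<le> \<alpha> + \<beta> * (b - a)" and ab: "a \<le> b"
  shows "v b - v a \<le> (\<beta> + 2 * \<alpha> / (\<delta> * (L - 2))) * (b - a)"
proof -
  define K where "K = 2 * \<alpha> / (\<delta> * (L - 2))"
  have "v b - v a \<le> (2 / L) ^ n * \<alpha> + (\<beta> + K * (1 - (2 / L) ^ n)) * (b - a)" for n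
  proof -
    have "L ^ n * (v b - v a) \<le> 2 ^ n * \<alpha> + (L ^ n * \<beta> + K * (L ^ n - 2 ^ n)) * (b - a)"
      unfolding K_def by (rule growth[OF assms])
    also have "\<dots> = L ^ n * ((2 / L) ^ n * \<alpha> + (\<beta> + K * (1 - (2 / L) ^ n)) * (b - a))"
      using L by (simp add: power_divide field_simps)
    finally show ?thesis using L by simp
  qed
  moreover have "(\<lambda>n. (2 / L) ^ n * \<alpha> + (\<beta> + K * (1 - (2 / L) ^ n)) * (b - a))
      \<longlonglongrightarrow> 0 * \<alpha> + (\<beta> + K * (1 - 0)) * (b - a)"
    using L by (intro tendsto_intros LIMSEQ_power_zero) auto
  ultimately have "v b - v a \<le> 0 * \<alpha> + (\<beta> + K * (1 - 0)) * (b - a)"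
    by (intro LIMSEQ_le_const) auto
  then show ?thesis by (simp add: K_def)
qed

text \<open>Far out on either side, boundedness keeps the increments below the positive one at
  \<open>z\<close>. Hence the maximum over a compact interval containing \<open>z\<close> is
  global.\<close>

lemma mono_bounded_increment_attains_max:
  fixes v :: "real \<Rightarrow> real"
  assumes mono: "mono v" and bd: "\<And>x. \<bar>v x\<bar> \<le> B" and cont: "continuous_on UNIV v"
    and \<delta>: "\<delta> > 0" and pos: "v (z + \<delta>) - v z > 0"
  obtains y where "\<And>x. v (x + \<delta>) - v x \<le> v (y + \<delta>) - v y"
proof -
  define \<epsilon> where "\<epsilon> = v (z + \<delta>) - v z"
  have bA: "bdd_above (range v)" and bB: "bdd_below (range v)"
    using bd by (auto simp: abs_le_iff minus_le_iff intro!: bdd_aboveI[of _ B] bdd_belowI[of _ "-B"])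
  have "Sup (range v) - \<epsilon> < Sup (range v)" using pos by (simp add: \<epsilon>_def)
  then obtain p where p: "Sup (range v) - \<epsilon> < v p"
    using less_cSup_iff[OF _ bA] by auto
  have "Inf (range v) < Inf (range v) + \<epsilon>" using pos by (simp add: \<epsilon>_def)
  then obtain q where q: "v q < Inf (range v) + \<epsilon>"
    using cInf_lessD[of "range v" "Inf (range v) + \<epsilon>"] by auto
  have hi: "v (x + \<delta>) - v x \<le> \<epsilon>" if "x \<ge> p" for x
    using cSup_upper[OF _ bA, of "v (x + \<delta>)"] monoD[OF mono that] p by auto
  have lo: "v (x + \<delta>) - v x \<le> \<epsilon>" if "x + \<delta> \<le> q" for x
    using cInf_lower[OF _ bB, of "v x"] monoD[OF mono that] q by auto
  define I where "I = {min z (q - \<delta>)..max z p}"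
  have "z \<in> I" by (simp add: I_def)
  have "continuous_on I (\<lambda>x. v (x + \<delta>) - v x)"
    by (intro continuous_intros continuous_on_compose2[OF cont]) auto
  moreover have "compact I" by (simp add: I_def)
  ultimately obtain y where y: "y \<in> I" "\<And>x. x \<in> I \<Longrightarrow> v (x + \<delta>) - v x \<le> v (y + \<delta>) - v y"
    using continuous_attains_sup[of I "\<lambda>x. v (x + \<delta>) - v x"] \<open>z \<in> I\<close> by blast
  have \<epsilon>_le: "\<epsilon> \<le> v (y + \<delta>) - v y" using y(2)[OF \<open>z \<in> I\<close>] by (simp add: \<epsilon>_def)
  have "v (x + \<delta>) - v x \<le> v (y + \<delta>) - v y" for x
  proof -
    consider "x \<ge> p" | "x + \<delta> \<le> q" | "x \<in> I" by (force simp: I_def min_le_iff_disj le_max_iff_disj)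
    then show ?thesis
      using hi[of x] lo[of x] y(2)[of x] \<epsilon>_le
      by cases linarith+
  qed
  then show thesis by (rule that)
qed

section \<open>Bounded monotone solutions are constant\<close>

lemma conformal_bounded_imp_const:
  assumes lam: "lam > 1" and loc: "locally_affine F lam" and per: "\<And>x. F (x + 1) = F x + 1"
    and cF: "continuous_on UNIV F" and trans: "topologically_transitive F"
    and conf: "conformal F lam m v" and m: "m > 0"
    and cv: "continuous_on UNIV v" and mono: "mono v" and bd: "\<And>x. \<bar>v x\<bar> \<le> B"
  shows "v p = v q"
proof (rule ccontr)
  assume ne: "v p \<noteq> v q"
  \<comment> \<open>An interval of constancy would spread over the whole line.\<close>
  have strict: "v a < v b" if "a < b" for a b
  proof (rule ccontr)
    assume "\<not> v a < v b"
    then have "v x = v a" if "x \<in> {a..b}" for x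
      using that monoD[OF mono, of a x] monoD[OF mono, of x b] by auto
    then have "v p = v q" by (rule conformal_const_spread[OF lam loc per cF trans conf cv that])
    with ne show False ..
  qed
  have B: "B \<ge> 0" using bd[of 0] by linarith
  \<comment> \<open>Slope above 4 gives \<open>2 / (L - 2) < 1\<close>, which makes both
    \<open>c > 0\<close> and \<open>\<theta> < 1\<close> below.\<close>
  obtain N where N: "4 < lam ^ N" using real_arch_pow[OF lam] by blast
  then have "N > 0" by (cases N) auto
  define G L M where "G = F ^^ N" and "L = lam ^ N" and "M = m ^ N"
  have L: "L > 4" and M: "M > 0" using N m by (simp_all add: L_def M_def)
  have perG: "G (x + 1) = G x + 1" for x unfolding G_def by (rule degree_one_funpow[of F, OF per])
  have "locally_affine G L" unfolding G_def L_def using locally_affine_funpow[OF _ loc] lam by simp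
  from uniform_splits[OF this perG] obtain \<delta> where \<delta>: "\<delta> > 0" and sp: "splits G L \<delta>" by blast
  have confG: "conformal G L M v"
    unfolding G_def L_def M_def using conformal_funpow[OF _ loc conf] lam by simp
  have bd2: "v b - v a \<le> 2 * B + 0 * (b - a)" for a b using bd[of a] bd[of b] by (simp add: abs_le_iff)
  \<comment> \<open>Boundedness is a growth bound with \<open>\<beta> = 0\<close>, so
    \<open>M ^ n\<close> is at most a constant times \<open>L ^ n\<close>.\<close>
  have "M \<le> L"
  proof (rule ccontr)
    assume "\<not> M \<le> L"
    define K where "K = 2 * (2 * B) / (\<delta> * (L - 2))"
    define D where "D = v 1 - v 0"
    have D: "D > 0" using strict by (simp add: D_def)
    have K: "K \<ge> 0" using B \<delta> L by (simp add: K_def)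
    obtain n where n: "(2 * B + K) / D < (M / L) ^ n"
      using real_arch_pow[of "M / L"] \<open>\<not> M \<le> L\<close> L by auto
    have "M ^ n * D \<le> 2 ^ n * (2 * B) + (L ^ n * 0 + K * (L ^ n - 2 ^ n)) * (1 - 0)"
      unfolding K_def D_def using L B bd2 by (intro growth[OF sp \<delta> _ confG]) auto
    also have "\<dots> \<le> L ^ n * (2 * B) + K * L ^ n"
    proof -
      have "2 ^ n * (2 * B) \<le> L ^ n * (2 * B)"
        using L B by (intro mult_right_mono power_mono) auto
      moreover have "K * (L ^ n - 2 ^ n) \<le> K * L ^ n" using K by (intro mult_left_mono) auto
      ultimately show ?thesis by simp
    qed
    finally have "M ^ n * D \<le> L ^ n * (2 * B + K)" by (simp add: algebra_simps)
    moreover have "L ^ n * (2 * B + K) < M ^ n * D"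
      using n L D by (simp add: power_divide field_simps)
    ultimately show False by linarith
  qed
  \<comment> \<open>A lower growth bound needs increments bounded away from 0 at a fixed scale. The
    bounded \<open>v\<close> lacks these, but its periodization \<open>w\<close> has them.\<close>
  moreover have "L \<le> M"
  proof (rule ccontr)
    assume less: "\<not> L \<le> M"
    obtain w where w: "conformal G L M w"
      and vw: "\<And>a b k. a \<le> b \<Longrightarrow> v (b + of_int k) - v (a + of_int k) \<le> w b - w a"
      using periodize[OF mono bd perG confG] by blast
    have "continuous_on {0..1} (\<lambda>x. v (x + \<delta>) - v x)"
      by (intro continuous_intros continuous_on_compose2[OF cv]) auto
    from continuous_attains_inf[OF _ _ this]
    obtain y where y: "\<And>x. x \<in> {0..1} \<Longrightarrow> v (y + \<delta>) - v y \<le> v (x + \<delta>) - v x"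
      by (metis atLeastatMost_empty_iff2 compact_Icc zero_less_one_class.zero_le_one)
    define \<epsilon> where "\<epsilon> = v (y + \<delta>) - v y"
    have \<epsilon>: "\<epsilon> > 0" using strict \<delta> by (simp add: \<epsilon>_def)
    have w_step: "\<epsilon> \<le> w (x + \<delta>) - w x" for x
    proof -
      have "x + of_int (- \<lfloor>x\<rfloor>) \<in> {0..1}" unfolding atLeastAtMost_iff by (simp, linarith)
      from y[OF this] have "\<epsilon> \<le> v (x + \<delta> + of_int (- \<lfloor>x\<rfloor>)) - v (x + of_int (- \<lfloor>x\<rfloor>))"
        by (simp add: \<epsilon>_def algebra_simps)
      also have "\<dots> \<le> w (x + \<delta>) - w x" using \<delta> by (intro vw) simp
      finally show ?thesis .
    qed
    have w_mono: "w a \<le> w b" if "a \<le> b" for a b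
      using vw[OF that, of 0] monoD[OF mono that] by simp
    \<comment> \<open>The sign change turns the lower bound \<open>\<epsilon> / \<delta>\<close> for
      the mean slope of \<open>w\<close> into a negative \<open>\<beta>\<close> in
      \<open>growth\<close>.\<close>
    define u where "u x = - 1 * w x" for x
    have uc: "conformal G L M u" unfolding u_def by (rule conformal_scale[OF w])
    have ub: "u b - u a \<le> \<epsilon> + (- \<epsilon> / \<delta>) * (b - a)" if "a \<le> b" for a b
    proof (rule bound_from_short[OF \<delta> _ _ that])
      show "u (x + \<delta>) - u x \<le> (- \<epsilon> / \<delta>) * \<delta>" for x using w_step[of x] \<delta> by (simp add: u_def)
      fix a b assume "a \<le> b" "b \<le> a + \<delta>"
      then have "\<epsilon> / \<delta> * (b - a) \<le> \<epsilon> / \<delta> * \<delta>" using \<epsilon> \<delta> by (intro mult_left_mono) auto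
      then show "u b - u a \<le> \<epsilon> + (- \<epsilon> / \<delta>) * (b - a)"
        using w_mono[OF \<open>a \<le> b\<close>] \<delta> by (simp add: u_def)
    qed
    define K where "K = 2 * \<epsilon> / (\<delta> * (L - 2))"
    \<comment> \<open>The linear rate that remains after the cutting errors.\<close>
    define c where "c = \<epsilon> / \<delta> - K"
    have c: "c > 0" using \<epsilon> \<delta> L by (simp add: c_def K_def field_simps)
    have "(M / L) ^ n * (u 1 - u 0) \<le> (2 / L) ^ n * \<epsilon> + (- \<epsilon> / \<delta> + K * (1 - (2 / L) ^ n))" for n
    proof -
      have "M ^ n * (u 1 - u 0) \<le> 2 ^ n * \<epsilon> + (L ^ n * (- \<epsilon> / \<delta>) + K * (L ^ n - 2 ^ n)) * (1 - 0)"
        unfolding K_def using \<epsilon> L ub by (intro growth[OF sp \<delta> _ uc]) auto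
      then have "M ^ n * (u 1 - u 0) / L ^ n \<le> (2 ^ n * \<epsilon> + (L ^ n * (- \<epsilon> / \<delta>) + K * (L ^ n - 2 ^ n))) / L ^ n"
        using L by (intro divide_right_mono) auto
      also have "\<dots> = (2 / L) ^ n * \<epsilon> + (- \<epsilon> / \<delta> + K * (1 - (2 / L) ^ n))"
        using L by (simp add: power_divide add_divide_distrib diff_divide_distrib right_diff_distrib)
      finally show ?thesis by (simp add: power_divide)
    qed
    moreover have "(\<lambda>n. (M / L) ^ n * (u 1 - u 0)) \<longlonglongrightarrow> 0 * (u 1 - u 0)"
      using less L M by (intro tendsto_intros LIMSEQ_power_zero) auto
    moreover have "(\<lambda>n. (2 / L) ^ n * \<epsilon> + (- \<epsilon> / \<delta> + K * (1 - (2 / L) ^ n)))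
        \<longlonglongrightarrow> 0 * \<epsilon> + (- \<epsilon> / \<delta> + K * (1 - 0))"
      using L by (intro tendsto_intros LIMSEQ_power_zero) auto
    \<comment> \<open>If \<open>M < L\<close>, the left side tends to 0 and the right side to
      \<open>- c\<close>.\<close>
    ultimately have "0 * (u 1 - u 0) \<le> 0 * \<epsilon> + (- \<epsilon> / \<delta> + K * (1 - 0))"
      by (intro LIMSEQ_le) auto
    then show False using c by (simp add: c_def)
  qed
  ultimately have M_eq: "M = L" by simp
  then have "m = lam"
    using power_eq_imp_eq_base[of m N lam] \<open>N > 0\<close> m lam by (simp add: M_def L_def)
  have confG: "conformal G L L v" using confG M_eq by simp
  obtain y where y: "\<And>x. v (x + \<delta>) - v x \<le> v (y + \<delta>) - v y"
    using mono_bounded_increment_attains_max[OF mono bd cv \<delta>, of 0] strict[of 0 \<delta>] \<delta> by auto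
  \<comment> \<open>The largest mean slope of \<open>v\<close> over segments of length
    \<open>\<delta>\<close>.\<close>
  define s where "s = (v (y + \<delta>) - v y) / \<delta>"
  have s: "s > 0" using strict \<delta> by (simp add: s_def)
  have step: "v (x + \<delta>) - v x \<le> s * \<delta>" for x using y[of x] \<delta> by (simp add: s_def)
  define \<theta> where "\<theta> = 2 / (L - 2)"
  have \<theta>: "0 \<le> \<theta>" "\<theta> < 1" using L by (simp_all add: \<theta>_def)
  define C where "C = 2 * (2 * B) / (\<delta> * (L - 2))"
  have C: "C \<ge> 0" using B \<delta> L by (simp add: C_def)
  \<comment> \<open>Bootstrap: if the Lipschitz constant exceeds \<open>s\<close> by
    \<open>\<theta> ^ i * C\<close>, then over length \<open>\<delta>\<close> the excess is at most
    \<open>\<theta> ^ i * C * \<delta>\<close>. It does not accumulate, as full steps of length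
    \<open>\<delta>\<close> have mean slope at most \<open>s\<close>; \<open>growth_limit\<close>
    then shrinks it by the factor \<open>\<theta>\<close>.\<close>
  have lip: "a \<le> b \<Longrightarrow> v b - v a \<le> (s + \<theta> ^ i * C) * (b - a)" for i a b
  proof (induction i arbitrary: a b)
    case 0
    have "v b - v a \<le> (0 + 2 * (2 * B) / (\<delta> * (L - 2))) * (b - a)"
      using L B bd2 0 by (intro growth_limit[OF sp \<delta> _ confG]) auto
    also have "\<dots> \<le> (s + \<theta> ^ 0 * C) * (b - a)"
      using s 0 by (intro mult_right_mono) (auto simp: C_def)
    finally show ?case .
  next
    case (Suc i)
    have "v b - v a \<le> \<theta> ^ i * C * \<delta> + s * (b - a)" if "a \<le> b" for a b
    proof (rule bound_from_short[of \<delta> v s, OF \<delta> step _ that])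
      fix a b assume "a \<le> b" "b \<le> a + \<delta>"
      then have "\<theta> ^ i * C * (b - a) \<le> \<theta> ^ i * C * \<delta>" using \<theta> C by (intro mult_left_mono) auto
      then show "v b - v a \<le> \<theta> ^ i * C * \<delta> + s * (b - a)"
        using Suc.IH[OF \<open>a \<le> b\<close>] by (simp add: algebra_simps)
    qed
    then have "v b - v a \<le> (s + 2 * (\<theta> ^ i * C * \<delta>) / (\<delta> * (L - 2))) * (b - a)"
      using L \<theta> C \<delta> Suc.prems by (intro growth_limit[OF sp \<delta> _ confG]) auto
    also have "2 * (\<theta> ^ i * C * \<delta>) / (\<delta> * (L - 2)) = \<theta> ^ Suc i * C"
      using \<delta> by (simp add: \<theta>_def)
    finally show ?case .
  qed
  have lip: "v b - v a \<le> s * (b - a)" if "a \<le> b" for a b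
  proof -
    have "(\<lambda>i. (s + \<theta> ^ i * C) * (b - a)) \<longlonglongrightarrow> (s + 0 * C) * (b - a)"
      using \<theta> by (intro tendsto_intros LIMSEQ_power_zero) auto
    then have "v b - v a \<le> (s + 0 * C) * (b - a)"
      using lip[OF that] by (intro LIMSEQ_le_const) auto
    then show ?thesis by simp
  qed
  \<comment> \<open>Equal rates make this difference conformal, and \<open>lip\<close> makes it
    nondecreasing.\<close>
  define u where "u x = s * x + - 1 * v x" for x
  have u_conf: "conformal F lam lam u"
    unfolding u_def using conf \<open>m = lam\<close> by (intro conformal_add conformal_scale conformal_id) auto
  have u_cont: "continuous_on UNIV u" unfolding u_def by (intro continuous_intros cv)
  \<comment> \<open>At the maximising segment the values of \<open>u\<close> at both ends agree, so
    monotonicity leaves no room between them.\<close>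
  have u_const: "u x = u y" if "x \<in> {y..y + \<delta>}" for x
  proof -
    have "v (y + \<delta>) - v y = s * \<delta>" using \<delta> by (simp add: s_def)
    then show ?thesis using lip[of y x] lip[of x "y + \<delta>"] that by (simp add: u_def algebra_simps)
  qed
  have "y < y + \<delta>" using \<delta> by simp
  from conformal_const_spread[OF lam loc per cF trans u_conf u_cont this u_const]
  \<comment> \<open>Between these points \<open>v\<close> would rise by \<open>2 * B + 1\<close>,
    more than its bound permits.\<close>
  have "u ((2 * B + 1) / s) = u 0" .
  then show False using s bd2[of "(2 * B + 1) / s" 0] by (simp add: u_def)
qed

section \<open>Liftings and interval maps of constant slope\<close>

lemma circle_proj_eq_iff: "circle_proj x = circle_proj y \<longleftrightarrow> x - y \<in> \<int>"
  by (simp add: circle_proj_def circle.abs_eq_iff int_cong_def)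

lemma continuous_circle_proj: "continuous_on S circle_proj"
proof -
  have "continuous_on UNIV circle_proj"
    by (simp add: continuous_on_open_vimage open_circle_def)
  then show ?thesis by (rule continuous_on_subset) simp
qed

text \<open>The difference is continuous with integer values, and a connected countable set of reals
  is a point. This carries slope and degree over from one lifting to another.\<close>

lemma liftings_differ_by_const:
  assumes "lifting f F" "lifting f F'"
  obtains k where "k \<in> \<int>" "\<And>x. F x = F' x + k"
proof -
  define D where "D x = F x - F' x" for x
  have "circle_proj (F x) = circle_proj (F' x)" for x
    using assms unfolding lifting_def by (metis comp_apply)
  then have int: "D x \<in> \<int>" for x by (simp add: D_def circle_proj_eq_iff)
  have "continuous_on UNIV D"
    using assms unfolding D_def lifting_def by (intro continuous_intros) auto
  then have conn: "connected (range D)" by (intro connected_continuous_image) auto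
  have "countable (range D)"
    using int by (intro countable_subset[OF _ countable_int]) auto
  then have "D x = D 0" for x using connected_uncountable[OF conn, of "D x" "D 0"] by auto
  then have "F x = F' x + D 0" for x by (metis D_def add.commute diff_add_cancel)
  with int[of 0] show thesis by (rule that)
qed

lemma finite_circle_fibre: "finite (circle_proj -` {p} \<inter> {a..b})"
proof (cases "circle_proj -` {p} \<inter> {a..b} = {}")
  case False
  then obtain y where y: "circle_proj y = p" "y \<in> {a..b}" by blast
  have "circle_proj -` {p} \<inter> {a..b} \<subseteq> (\<lambda>i. y + i) ` {i \<in> \<int>. a - b \<le> i \<and> i \<le> b - a}"
  proof
    fix z assume z: "z \<in> circle_proj -` {p} \<inter> {a..b}"
    then have "z - y \<in> \<int>" using y circle_proj_eq_iff[of z y] by simp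
    then show "z \<in> (\<lambda>i. y + i) ` {i \<in> \<int>. a - b \<le> i \<and> i \<le> b - a}"
      using z y by (intro image_eqI[of _ _ "z - y"]) auto
  qed
  then show ?thesis by (rule finite_subset) (intro finite_imageI finite_int_segment)
qed simp

text \<open>The preimage of \<open>P\<close> is locally finite, so on either side of
  \<open>x\<close> a short open segment avoids it and lies in a single component; continuity adds
  the endpoint \<open>x\<close>.\<close>

lemma locally_affine_lifting:
  assumes lam: "lam > 0" and slope: "circle_constant_slope f lam" and F: "lifting f F"
  shows "locally_affine F lam"
  unfolding locally_affine_def
proof (intro allI ballI)
  fix x \<sigma> :: real assume \<sigma>: "\<sigma> \<in> {-1, 1}"
  obtain F' P where F': "lifting f F'" "finite P"
    and comp: "\<And>C J. C \<in> components (UNIV - P) \<Longrightarrow> J \<in> components (circle_proj -` C) \<Longrightarrow>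
        \<exists>s. \<bar>s\<bar> = lam \<and> affine_with_slope_on J s F'"
    using slope unfolding circle_constant_slope_def by blast
  obtain k where k: "\<And>x. F x = F' x + k" using liftings_differ_by_const[OF F F'(1)] by blast
  have "circle_proj -` P \<inter> {x - 1..x + 1} = (\<Union>p\<in>P. circle_proj -` {p} \<inter> {x - 1..x + 1})" by auto
  moreover have "finite (\<Union>p\<in>P. circle_proj -` {p} \<inter> {x - 1..x + 1})"
    by (intro finite_UN_I F'(2) finite_circle_fibre)
  ultimately have "finite (circle_proj -` P \<inter> {x - 1..x + 1})" by (simp only:)
  from finite_set_avoid[OF this, of x] obtain d where d: "d > 0"
    "\<And>y. circle_proj y \<in> P \<Longrightarrow> y \<in> {x - 1..x + 1} \<Longrightarrow> y \<noteq> x \<Longrightarrow> d \<le> dist x y"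
    by auto
  define e where "e = min d 1"
  have e: "0 < e" "e \<le> 1" "e \<le> d" using d(1) by (auto simp: e_def)
  \<comment> \<open>The segment omits \<open>x\<close>, which may itself project into
    \<open>P\<close>.\<close>
  define I where "I = (\<lambda>t. x + \<sigma> * t) ` {0<..<e}"
  have I_conn: "connected I"
    unfolding I_def by (intro connected_continuous_image continuous_intros) simp
  have avoid: "circle_proj y \<notin> P" if "y \<in> I" for y
    using that d(2)[of y] \<sigma> e by (auto simp: I_def dist_real_def)
  define p where "p = x + \<sigma> * (e / 2)"
  have p: "p \<in> I" unfolding I_def p_def using e(1) by (intro imageI) simp
  define C where "C = connected_component_set (UNIV - P) (circle_proj p)"
  define J where "J = connected_component_set (circle_proj -` C) p"
  have "C \<in> components (UNIV - P)" using avoid[OF p] by (auto simp: C_def components_def)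
  moreover have IC: "circle_proj ` I \<subseteq> C"
    unfolding C_def using avoid p
    by (intro connected_component_maximal connected_continuous_image continuous_circle_proj I_conn) auto
  then have "J \<in> components (circle_proj -` C)" using p by (auto simp: J_def components_def)
  ultimately obtain s b where s: "\<bar>s\<bar> = lam" and b: "\<And>y. y \<in> J \<Longrightarrow> F' y = s * y + b"
    using comp unfolding affine_with_slope_on_def by blast
  have "I \<subseteq> J"
    unfolding J_def using IC p by (intro connected_component_maximal I_conn) auto
  define w where "w t = F' (x + \<sigma> * t) - (s * (x + \<sigma> * t) + b)" for t
  have cF': "continuous_on UNIV F'" using F'(1) by (simp add: lifting_def)
  have "w t = 0" if "t \<in> {0..e}" for t
  proof (rule continuous_constant_on_closure[of "{0<..<e}" w])
    show "continuous_on (closure {0<..<e}) w"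
      unfolding w_def by (intro continuous_intros continuous_on_compose2[OF cF']) auto
    show "w t = 0" if "t \<in> {0<..<e}" for t
    proof -
      have "x + \<sigma> * t \<in> J" using that \<open>I \<subseteq> J\<close> unfolding I_def by blast
      from b[OF this] show ?thesis by (simp add: w_def)
    qed
    show "t \<in> closure {0<..<e}" using that e(1) by simp
  qed
  then have aff: "F (x + \<sigma> * t) = s * (x + \<sigma> * t) + b + k" if "t \<in> {0..e}" for t
    using that k by (simp add: w_def)
  \<comment> \<open>The direction of the image: that of the segment times the sign of the
    slope.\<close>
  define \<tau> where "\<tau> = \<sigma> * s / lam"
  have "\<tau> \<in> {-1, 1}" using \<sigma> s lam by (auto simp: \<tau>_def abs_if split: if_splits)
  moreover have "\<tau> * lam = \<sigma> * s" using lam by (simp add: \<tau>_def)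
  then have "ray_affine F lam x \<sigma> \<tau> e"
    using aff[of 0] aff e(1) by (auto simp: ray_affine_def algebra_simps)
  ultimately show "\<exists>e>0. \<exists>\<tau>\<in>{-1, 1}. ray_affine F lam x \<sigma> \<tau> e" using e(1) by blast
qed

text \<open>On the complement of the countable exceptional set \<open>k x - s \<mu> x\<close> is locally constant, hence
  takes only countably many values; being continuous, it is constant.\<close>
lemma interval_constant_slope_monotone_branch:
  assumes k: "interval_constant_slope k \<mu>" and \<mu>: "\<mu> > 0"
    and cd: "0 \<le> c" "c \<le> d" "d \<le> 1" and s: "s \<in> {-1, 1}"
    and mono: "\<And>x y. c \<le> x \<Longrightarrow> x \<le> y \<Longrightarrow> y \<le> d \<Longrightarrow> 0 \<le> s * (k y - k x)"
  shows "k d - k c = s * \<mu> * (d - c)"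
proof -
  obtain Q where Q: "closed Q" "countable Q"
    and comp: "\<And>J. J \<in> components ({0..1} - Q) \<Longrightarrow> \<exists>s. \<bar>s\<bar> = \<mu> \<and> affine_with_slope_on J s k"
    and ck: "continuous_on {0..1} k"
    using k unfolding interval_constant_slope_def interval_map_def by blast
  define u where "u x = k x - s * \<mu> * x" for x
  \<comment> \<open>Near such a point \<open>u\<close> is constant, so its value is also taken at a
    rational point.\<close>
  have rat: "u x \<in> u ` \<rat>" if x: "x \<in> {c<..<d} - Q" for x
  proof -
    have "open ({c<..<d} - Q)" using Q(1) by (intro open_Diff) auto
    then obtain r where r: "r > 0" "ball x r \<subseteq> {c<..<d} - Q"
      using x unfolding open_contains_ball by blast
    define J where "J = connected_component_set ({0..1} - Q) x"
    have "J \<in> components ({0..1} - Q)" using x cd by (auto simp: J_def components_def)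
    then obtain s' b where s': "\<bar>s'\<bar> = \<mu>" and b: "\<And>y. y \<in> J \<Longrightarrow> k y = s' * y + b"
      using comp unfolding affine_with_slope_on_def by blast
    have "ball x r \<subseteq> J"
      unfolding J_def using r cd by (intro connected_component_maximal) auto
    then have b: "k y = s' * y + b" if "y \<in> ball x r" for y using that b by blast
    have "x + r / 2 \<in> ball x r" using r(1) by (simp add: dist_real_def)
    then have "c \<le> x" "x + r / 2 \<le> d" using r(2) x by auto
    then have "0 \<le> s * (k (x + r / 2) - k x)" using r(1) by (intro mono) auto
    also have "k (x + r / 2) - k x = s' * (r / 2)"
      using b[of x] b[of "x + r / 2"] r(1) by (simp add: dist_real_def algebra_simps)
    finally have "0 \<le> (s * s') * (r / 2)" by (simp only: mult.assoc)
    then have "0 \<le> s * s'" using r(1) by (simp add: zero_le_mult_iff[of "s * s'"])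
    \<comment> \<open>Monotonicity decides the sign of the local slope, which constant slope leaves
      open.\<close>
    then have "s' = s * \<mu>" using s s' \<mu> by (auto simp: abs_if split: if_splits)
    obtain q where q: "q \<in> \<rat>" "x < q" "q < x + r" using Rats_dense_in_real[of x "x + r"] r(1) by auto
    have "u x = u q"
      using b[of x] b[of q] q r(1) \<open>s' = s * \<mu>\<close> by (simp add: u_def dist_real_def)
    with q(1) show ?thesis by blast
  qed
  have conn: "connected (u ` {c..d})"
    unfolding u_def using cd
    by (intro connected_continuous_image continuous_intros continuous_on_subset[OF ck]) auto
  have "u ` {c..d} \<subseteq> u ` (Q \<union> {c, d} \<union> \<rat>)"
  proof
    fix z assume "z \<in> u ` {c..d}"
    then obtain x where x: "x \<in> {c..d}" "z = u x" by blast
    consider "x \<in> Q \<union> {c, d}" | "x \<in> {c<..<d} - Q" using x(1) by force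
    then show "z \<in> u ` (Q \<union> {c, d} \<union> \<rat>)" using rat[of x] x(2) by cases blast+
  qed
  moreover have "countable (u ` (Q \<union> {c, d} \<union> \<rat>))"
    using Q(2) countable_rat by (intro countable_image countable_Un) auto
  ultimately have "countable (u ` {c..d})" by (rule countable_subset)
  then have "u d = u c" using connected_uncountable[OF conn, of "u d" "u c"] cd by auto
  then show ?thesis by (simp add: u_def algebra_simps)
qed

text \<open>Along an affine segment of \<open>F\<close> both \<open>\<psi>\<close> and
  \<open>\<psi> \<circ> F\<close> are monotone. Hence \<open>k\<close> is monotone on the interval
  swept by \<open>\<psi>\<close>, and such a branch multiplies lengths by
  \<open>\<mu>\<close>.\<close>

lemma conformal_of_semiconjugacy:
  assumes k: "interval_constant_slope k \<mu>" and \<mu>: "\<mu> > 0" and lam: "lam > 0"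
    and semi: "\<And>y. \<psi> (F y) = k (\<psi> y)" and c\<psi>: "continuous_on UNIV \<psi>" and ran: "\<And>y. \<psi> y \<in> {0..1}"
    and \<eta>: "\<eta> \<in> {-1, 1}" and mono: "mono (\<lambda>y. \<eta> * \<psi> y)"
  shows "conformal F lam \<mu> \<psi>"
  unfolding conformal_def
proof (intro allI ballI impI)
  fix x e \<sigma> \<tau> :: real
  assume \<sigma>: "\<sigma> \<in> {-1, 1}" and \<tau>: "\<tau> \<in> {-1, 1}" and e: "0 \<le> e"
    and ray: "ray_affine F lam x \<sigma> \<tau> e"
  define \<gamma> where "\<gamma> t = \<psi> (x + \<sigma> * t)" for t
  have k\<gamma>: "k (\<gamma> t) = \<psi> (F x + \<tau> * lam * t)" if "t \<in> {0..e}" for t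
    using ray that semi unfolding \<gamma>_def ray_affine_def by metis
  have dir: "0 \<le> \<rho> * \<eta> * (\<psi> (z + \<rho> * (l * t)) - \<psi> (z + \<rho> * (l * t')))"
    if "t' \<le> t" "\<rho> \<in> {-1, 1}" "l > 0" for t t' z \<rho> l :: real
  proof -
    have "l * t' \<le> l * t" using that by (intro mult_left_mono) auto
    then show ?thesis
      using that(2) monoD[OF mono, of "z + l * t'" "z + l * t"] monoD[OF mono, of "z - l * t" "z - l * t'"]
      by (auto simp: right_diff_distrib)
  qed
  have c\<gamma>: "continuous_on {0..e} \<gamma>"
    unfolding \<gamma>_def by (intro continuous_intros continuous_on_compose2[OF c\<psi>]) auto
  have ivl: "is_interval (\<gamma> ` {0..e})"
    unfolding is_interval_connected_1 by (intro connected_continuous_image c\<gamma>) auto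
  \<comment> \<open>Values between the end values are taken by \<open>\<gamma>\<close>, and
    \<open>\<sigma>\<close> and \<open>\<eta>\<close> fix the order of their parameters. The bounds
    \<open>l\<close> and \<open>r\<close> let one statement cover both orders of
    \<open>\<gamma> 0\<close> and \<open>\<gamma> e\<close>.\<close>
  have branch: "0 \<le> \<sigma> * \<tau> * (k q - k p)"
    if pq: "p \<le> q" and l: "l \<in> {\<gamma> 0, \<gamma> e}" "l \<le> p" and r: "r \<in> {\<gamma> 0, \<gamma> e}" "q \<le> r" for p q l r
  proof (cases "p = q")
    case False
    have "\<gamma> 0 \<in> \<gamma> ` {0..e}" "\<gamma> e \<in> \<gamma> ` {0..e}" using e by auto
    then have "l \<in> \<gamma> ` {0..e}" "r \<in> \<gamma> ` {0..e}" using l r by auto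
    then have "p \<in> \<gamma> ` {0..e}" "q \<in> \<gamma> ` {0..e}"
      using ivl l(2) r(2) pq unfolding is_interval_1 by (meson order_trans)+
    then obtain t t' where t: "t \<in> {0..e}" "t' \<in> {0..e}" "p = \<gamma> t" "q = \<gamma> t'" by blast
    have less: "\<gamma> t < \<gamma> t'" using pq False t by simp
    show ?thesis
    proof (cases "t \<le> t'")
      case True
      have "0 \<le> \<sigma> * \<eta> * (\<gamma> t' - \<gamma> t)" using dir[OF True \<sigma>, of 1 x] by (simp add: \<gamma>_def)
      then have "\<sigma> * \<eta> \<ge> 0" using less by (simp add: zero_le_mult_iff)
      then have "\<sigma> = \<eta>" using \<sigma> \<eta> by auto
      then show ?thesis using dir[OF True \<tau> lam, of "F x"] t
        by (simp add: k\<gamma> mult.assoc mult.left_commute)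
    next
      case F: False
      then have le: "t' \<le> t" by simp
      have "0 \<le> \<sigma> * \<eta> * (\<gamma> t - \<gamma> t')" using dir[OF le \<sigma>, of 1 x] by (simp add: \<gamma>_def)
      then have "\<sigma> * \<eta> \<le> 0" using less by (simp add: zero_le_mult_iff)
      then have "\<sigma> = - \<eta>" using \<sigma> \<eta> by auto
      then show ?thesis using dir[OF le \<tau> lam, of "F x"] t
        by (simp add: k\<gamma> mult.assoc algebra_simps)
    qed
  qed simp
  have s: "\<sigma> * \<tau> \<in> {-1, 1}" using \<sigma> \<tau> by auto
  have "k (\<gamma> e) - k (\<gamma> 0) = \<sigma> * \<tau> * \<mu> * (\<gamma> e - \<gamma> 0)"
  proof (cases "\<gamma> 0 \<le> \<gamma> e")
    case True
    show ?thesis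
      using ran[of x] ran[of "x + \<sigma> * e"] True
      by (intro interval_constant_slope_monotone_branch[OF k \<mu> _ _ _ s] branch[of _ _ "\<gamma> 0" "\<gamma> e"])
         (auto simp: \<gamma>_def)
  next
    case False
    have "k (\<gamma> 0) - k (\<gamma> e) = \<sigma> * \<tau> * \<mu> * (\<gamma> 0 - \<gamma> e)"
      using ran[of x] ran[of "x + \<sigma> * e"] False
      by (intro interval_constant_slope_monotone_branch[OF k \<mu> _ _ _ s] branch[of _ _ "\<gamma> e" "\<gamma> 0"])
         (auto simp: \<gamma>_def)
    then show ?thesis by (simp add: algebra_simps)
  qed
  then show "\<psi> (F (x + \<sigma> * e)) - \<psi> (F x) = \<sigma> * \<tau> * \<mu> * (\<psi> (x + \<sigma> * e) - \<psi> x)"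
    by (simp add: semi \<gamma>_def)
qed

section \<open>Transfer of the semiconjugacy to the line\<close>

theorem theorem5p1:
  fixes f :: "circle \<Rightarrow> circle" and F g :: "real \<Rightarrow> real" and lam :: real
  assumes "continuous_on UNIV f"
    and "degree_one f"
    and "lam > 1"
    and "circle_constant_slope f lam"
    and "lifting f F"
    and "topologically_transitive F"
    and "interval_map g"
    and "interior_conjugate g F"
  shows "\<not> (\<exists>\<phi> k \<mu>. \<mu> > 0 \<and> interval_constant_slope k \<mu> \<and> nondecreasing_semiconjugacy \<phi> g k)"
proof
  assume "\<exists>\<phi> k \<mu>. \<mu> > 0 \<and> interval_constant_slope k \<mu> \<and> nondecreasing_semiconjugacy \<phi> g k"
  then obtain \<phi> k \<mu> where \<mu>: "\<mu> > 0" and k: "interval_constant_slope k \<mu>"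
    and c\<phi>: "continuous_on {0..1} \<phi>" and mono\<phi>: "mono_on {0..1} \<phi>" and onto: "\<phi> ` {0..1} = {0..1}"
    and semi: "\<And>x. x \<in> {0..1} \<Longrightarrow> \<phi> (g x) = k (\<phi> x)"
    unfolding nondecreasing_semiconjugacy_def by blast
  obtain h h' where g01: "g ` {0<..<1} \<subseteq> {0<..<1}" and hom: "homeomorphism {0<..<1} UNIV h h'"
    and hg: "\<And>x. x \<in> {0<..<1} \<Longrightarrow> h (g x) = F (h x)"
    using \<open>interior_conjugate g F\<close> unfolding interior_conjugate_def by blast
  have h'01: "range h' = {0<..<1}" and ch': "continuous_on UNIV h'"
    and hh': "\<And>y. h (h' y) = y" and h'h: "\<And>x. x \<in> {0<..<1} \<Longrightarrow> h' (h x) = x"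
    using hom by (auto simp: homeomorphism_def)
  have in01: "h' y \<in> {0<..<1}" "h' y \<in> {0..1}" for y
  proof -
    show "h' y \<in> {0<..<1}" using h'01 by blast
    then show "h' y \<in> {0..1}" by simp
  qed
  have lam: "lam > 0" using \<open>lam > 1\<close> by simp
  have loc: "locally_affine F lam"
    by (rule locally_affine_lifting[OF lam \<open>circle_constant_slope f lam\<close> \<open>lifting f F\<close>])
  have cF: "continuous_on UNIV F" using \<open>lifting f F\<close> by (simp add: lifting_def)
  have per: "F (x + 1) = F x + 1" for x
  proof -
    obtain F' where F': "lifting f F'" "\<And>x. F' (x + 1) = F' x + 1"
      using \<open>degree_one f\<close> unfolding degree_one_def by blast
    obtain c where "\<And>x. F x = F' x + c" using liftings_differ_by_const[OF \<open>lifting f F\<close> F'(1)] by blast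
    then show ?thesis using F'(2) by simp
  qed
  define \<psi> where "\<psi> y = \<phi> (h' y)" for y
  have c\<psi>: "continuous_on UNIV \<psi>"
    unfolding \<psi>_def using in01 by (intro continuous_on_compose2[OF c\<phi> ch']) auto
  have ran: "\<psi> y \<in> {0..1}" for y unfolding \<psi>_def using onto in01(2) by blast
  have semi\<psi>: "\<psi> (F y) = k (\<psi> y)" for y
  proof -
    have "h' (F y) = h' (h (g (h' y)))" using hg[OF in01(1)] hh' by simp
    also have "\<dots> = g (h' y)" using g01 in01(1) by (intro h'h) blast
    finally show ?thesis using semi[OF in01(2)] by (simp add: \<psi>_def)
  qed
  have "inj h'" using hh' by (metis injI)
  \<comment> \<open>The conjugacy may reverse orientation; \<open>\<eta>\<close> records
    this.\<close>
  then have "strict_mono_on UNIV h' \<or> strict_antimono_on UNIV h'"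
    using injective_eq_monotone_map[OF is_interval_univ ch'] by blast
  then obtain \<eta> :: real where \<eta>: "\<eta> \<in> {-1, 1}" and mono: "mono (\<lambda>y. \<eta> * \<psi> y)"
  proof
    assume "strict_mono_on UNIV h'"
    then have "mono h'" by (simp add: strict_mono_mono)
    then have "mono (\<lambda>y. 1 * \<psi> y)"
      unfolding \<psi>_def mono_def using mono_onD[OF mono\<phi> in01(2) in01(2)] by simp
    then show thesis by (rule that[rotated]) simp
  next
    assume "strict_antimono_on UNIV h'"
    then have "h' y \<le> h' x" if "x \<le> y" for x y
      using that by (cases "x = y") (auto simp: monotone_on_def less_le)
    then have "mono (\<lambda>y. - 1 * \<psi> y)"
      unfolding \<psi>_def mono_def using mono_onD[OF mono\<phi> in01(2) in01(2)] by simp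
    then show thesis by (rule that[rotated]) simp
  qed
  have "conformal F lam \<mu> (\<lambda>y. \<eta> * \<psi> y)"
    by (intro conformal_scale conformal_of_semiconjugacy[OF k \<mu> lam semi\<psi> c\<psi> ran \<eta> mono])
  moreover have "continuous_on UNIV (\<lambda>y. \<eta> * \<psi> y)" by (intro continuous_intros c\<psi>)
  moreover have "\<bar>\<eta> * \<psi> y\<bar> \<le> 1" for y using \<eta> ran[of y] by auto
  ultimately have "\<eta> * \<psi> y = \<eta> * \<psi> 0" for y
    using conformal_bounded_imp_const[OF \<open>lam > 1\<close> loc per cF \<open>topologically_transitive F\<close> _ \<mu> _ mono] by blast
  then have \<psi>_const: "\<psi> y = \<psi> 0" for y using \<eta> by auto
  \<comment> \<open>Constancy on the open interval passes to its closure, against the surjectivity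
    of \<open>\<phi>\<close>.\<close>
  have "\<phi> x = \<psi> 0" if "x \<in> {0..1}" for x
  proof (rule continuous_constant_on_closure[of "{0<..<1}" \<phi>])
    show "continuous_on (closure {0<..<1}) \<phi>" using c\<phi> by simp
    show "\<phi> z = \<psi> 0" if "z \<in> {0<..<1}" for z
      using \<psi>_const[of "h z"] h'h[OF that] by (simp add: \<psi>_def)
    show "x \<in> closure {0<..<1}" using that by simp
  qed
  moreover have "0 \<in> \<phi> ` {0..1}" "1 \<in> \<phi> ` {0..1}" using onto by auto
  ultimately have "(0 :: real) = 1" by (metis imageE)
  then show False by simp
qed

end
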